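(* The fibre product $\mathrm{Sp}(W)\times_{B_1}\mathbb B_1$ is isomorphic to the fibre product $\mathrm{Sp}(W)\times_{B_0}\mathbb B_0$, the isomorphism $B_1\to B_0$, $(\sigma,\gamma)\mapsto\big(\sigma,(\psi\circ\gamma)(\psi\circ f_\sigma)\big)$, being compatible with the respective maps (from $\mathrm{Sp}(W)$ and from $\mathbb B_1=\mathbb B_0$).
   Context: $F$ is a field of characteristic different from $2$, either finite or non-archimedean local, of residual characteristic $p$; $R$ is a field with a fixed non-trivial smooth character $\psi:F\to R^\times$. $(W,\langle\,,\rangle)$ is a finite-dimensional symplectic $F$-space with a fixed complete polarization $W=X+Y$ by Lagrangians; write $w=x+y$, identify $Y\simeq X^*$, and put $\mathcal B(w,w')=\langle x,y'\rangle$. $W^*$ is the algebraic dual of $W$. For $\sigma\in\mathrm{Sp}(W)$, $f_\sigma(w)=\tfrac12\big(\mathcal B(\sigma w,\sigma w)-\mathcal B(w,w)\big)$, a quadratic form on $W$. Construction of Weil: $A=W\times R^\times$ with law $(w,r)(w',r')=(w+w',rr'\psi(\mathcal B(w,w')))$, with centre $Z\simeq R^\times$. $B_0=\mathrm{Aut}_Z(A)$ is the group of automorphisms of $A$ trivial on $Z$, identified with $\mathrm{Sp}(W)\rtimes W^*$: $(\sigma,\tau)$ acts by $(w,r)\mapsto(\sigma(w),r\,\psi(f_\sigma(w))\,\psi(\tau(w)))$; the element is also written $(\sigma,(\psi\circ\tau)(\psi\circ f_\sigma))$. $U_0:A\to\mathrm{GL}_R(C_c^\infty(X))$ is the injective morphism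 $U_0(w,r)\phi(u)=r\,\psi(\langle u,y\rangle)\phi(u+x)$, with image $\mathbb A$; $\mathbb B_0$ is the normalizer of $\mathbb A$ in $\mathrm{GL}_R(C_c^\infty(X))$. The map $\mathbb B_0\to B_0$ sends $s$ to conjugation by $s$ on $\mathbb A\simeq A$; the map $\mathrm{Sp}(W)\to B_0$ sends $\sigma$ to the automorphism $(\sigma,0)$, i.e. $(w,r)\mapsto(\sigma w,r\psi(f_\sigma(w)))$. $\mathrm{Sp}(W)\times_{B_0}\mathbb B_0$ is the group of pairs $(\sigma,s)\in\mathrm{Sp}(W)\times\mathbb B_0$ with the same image in $B_0$. Heisenberg construction: $H=W\times F$ with $(w,t)(w',t')=(w+w',t+t'+\tfrac12\langle w,w'\rangle)$. $B_1=\mathrm{Sp}(W)\rtimes W^*$ is regarded as the group of automorphisms of $H$ trivial on the centre, $(\sigma,\gamma)$ acting by $(w,t)\mapsto(\sigma(w),t+\gamma(w))$. $U_1:H\to\mathrm{GL}_R(C_c^\infty(X))$ is the morphism $U_1(w,t)\phi(u)=\psi(t)\psi(\tfrac12\langle x,y\rangle)\psi(\langle u,y\rangle)\phi(u+x)$, with kernel $\ker\psi$ (in the centre) and image $\mathbb H\simeq H/\ker\psi$. $\mathbb B_1$ is the normalizer of $\mathbb H$ in $\mathrm{GL}_R(C_c^\infty(X))$. The map $\mathbb B_1\to B_1$ sends $s$ to conjugation by $s$ on $\mathbb H\simeq H/\ker\psi$, viewed in $B_1$ (identified with the automorphisms of $H/\ker\psi$ trivial on the centre); the map $\mathrm{Sp}(W)\to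 B_1$ is the canonical inclusion $\sigma\mapsto(\sigma,0)$. $\mathrm{Sp}(W)\times_{B_1}\mathbb B_1$ is the group of pairs $(\sigma,s)$ with the same image in $B_1$.
   Formalization: B_0 is taken as the automorphisms of A given by Sp(W)⋊W*, not all of Aut_Z(A) (larger e.g. for F=F_9); conjugation by s need not lie in B_i, so compatibility reads: s in 𝔹_1=𝔹_0 acts on H/ker ψ as b in B_1 iff it acts on A as the image of b. *)

theory Defs
  imports "HOL-Analysis.Analysis" "HOL-Algebra.Coset" "HOL-Algebra.Bij" "HOL-Algebra.Group_Action"
begin

section \<open>Finite and non-archimedean local fields\<close>

locale nonarch_local_field =
  fixes v :: "'f::field \<Rightarrow> real"
  assumes v_nonneg: "0 \<le> v x"
    and v_eq_0_iff: "v x = 0 \<longleftrightarrow> x = 0"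
    and v_mult: "v (x * y) = v x * v y"
    and v_ultrametric: "v (x + y) \<le> max (v x) (v y)"
    and v_nontrivial: "\<exists>x. x \<noteq> 0 \<and> v x \<noteq> 1"
    and v_locally_compact:
      "locally_compact_space (Metric_space.mtopology UNIV (\<lambda>x y. v (x - y)))"

text \<open>The field carries its topology \<open>T\<close>: discrete in the finite case, given by the absolute
  value in the local case. In the local case the condition on \<open>p\<close> says that \<open>p\<close> is the
  characteristic of the quotient of the valuation ring by its maximal ideal.\<close>

definition finite_or_local_field :: "'f::field topology \<Rightarrow> nat \<Rightarrow> bool" where
  "finite_or_local_field T p \<longleftrightarrow> prime p \<and>
     ((finite (UNIV :: 'f set) \<and> T = discrete_topology UNIV \<and> CHAR('f) = p) \<or>
      (\<exists>v. nonarch_local_field v \<and> T = Metric_space.mtopology UNIV (\<lambda>x y. v (x - y)) \<and>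
           (\<forall>n. v (of_nat n) < 1 \<longleftrightarrow> p dvd n)))"

definition locally_constant_on :: "'a topology \<Rightarrow> ('a \<Rightarrow> 'b) \<Rightarrow> bool" where
  "locally_constant_on T f \<longleftrightarrow>
     (\<forall>x\<in>topspace T. \<exists>U. openin T U \<and> x \<in> U \<and> (\<forall>y\<in>U. f y = f x))"

definition fibre_product ::
    "('a, 'm) monoid_scheme \<Rightarrow> ('b, 'n) monoid_scheme \<Rightarrow> ('a \<Rightarrow> 'c) \<Rightarrow> ('b \<Rightarrow> 'c) \<Rightarrow> ('a \<times> 'b) monoid"
  where "fibre_product G H f g =
    (G \<times>\<times> H)\<lparr>carrier := {(a, b). a \<in> carrier G \<and> b \<in> carrier H \<and> f a = g b}\<rparr>"

section \<open>The symplectic space with its polarization\<close>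

locale weil_setting = vector_space scale
  for scale :: "'f::field \<Rightarrow> 'w::ab_group_add \<Rightarrow> 'w" +
  fixes TF :: "'f topology"
    and p :: nat
    and form :: "'w \<Rightarrow> 'w \<Rightarrow> 'f"
    and X Y :: "'w set"
    and psi :: "'f \<Rightarrow> 'r::field"
  assumes char_not_2: "CHAR('f) \<noteq> 2"
    and finite_or_local: "finite_or_local_field TF p"
    and psi_add: "psi (a + b) = psi a * psi b"
    and psi_nonzero: "psi a \<noteq> 0"
    and psi_nontrivial: "\<exists>a. psi a \<noteq> 1"
    and psi_smooth: "locally_constant_on TF psi"
    and finite_dim: "\<exists>B. finite_dimensional_vector_space scale B"
    and form_linear_left: "Vector_Spaces.linear scale (*) (\<lambda>w. form w w')"
    and form_linear_right: "Vector_Spaces.linear scale (*) (form w)"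
    and form_alternating: "form w w = 0"
    and form_nondegenerate: "(\<And>w'. form w w' = 0) \<Longrightarrow> w = 0"
    and X_subspace: "subspace X"
    and Y_subspace: "subspace Y"
    and X_lagrangian: "X = {w. \<forall>x\<in>X. form w x = 0}"
    and Y_lagrangian: "Y = {w. \<forall>y\<in>Y. form w y = 0}"
    and polarization: "\<exists>!x. x \<in> X \<and> w - x \<in> Y"
begin

definition prX :: "'w \<Rightarrow> 'w" where
  "prX w = (THE x. x \<in> X \<and> w - x \<in> Y)"

definition prY :: "'w \<Rightarrow> 'w" where
  "prY w = w - prX w"

definition polB :: "'w \<Rightarrow> 'w \<Rightarrow> 'f" where
  "polB w w' = form (prX w) (prY w')"

definition dual :: "('w \<Rightarrow> 'f) set" where
  "dual = {\<tau>. Vector_Spaces.linear scale (*) \<tau>}"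

definition Sp :: "('w \<Rightarrow> 'w) monoid" where
  "Sp = \<lparr>carrier = {\<sigma>. Vector_Spaces.linear scale scale \<sigma> \<and> bij \<sigma> \<and>
                       (\<forall>w w'. form (\<sigma> w) (\<sigma> w') = form w w')},
         mult = (\<circ>), one = id\<rparr>"

definition quad :: "('w \<Rightarrow> 'w) \<Rightarrow> 'w \<Rightarrow> 'f" where
  "quad \<sigma> w = (polB (\<sigma> w) (\<sigma> w) - polB w w) / 2"

section \<open>The space of smooth compactly supported functions on \<open>X\<close>\<close>

text \<open>The topology of \<open>X\<close> is the product topology, transported by the coordinates in a basis; it
  does not depend on the basis.\<close>

definition X_basis :: "'w set" where
  "X_basis = (SOME B. independent B \<and> span B = X)"

definition TX :: "'w topology" where
  "TX = pullback_topology X (\<lambda>u. restrict (representation X_basis u) X_basis)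
          (product_topology (\<lambda>_. TF) X_basis)"

text \<open>A function on \<open>X\<close> is represented by its extension by zero to \<open>W\<close>.\<close>

definition Cc :: "('w \<Rightarrow> 'r) set" where
  "Cc = {\<phi>. (\<forall>u. u \<notin> X \<longrightarrow> \<phi> u = 0) \<and> locally_constant_on TX \<phi> \<and>
            compactin TX (Abstract_Topology.closure_of TX {u \<in> X. \<phi> u \<noteq> 0})}"

definition GL_Cc :: "(('w \<Rightarrow> 'r) \<Rightarrow> ('w \<Rightarrow> 'r)) monoid" where
  "GL_Cc = (BijGroup Cc)\<lparr>carrier :=
     {g \<in> Bij Cc. (\<forall>\<phi>\<in>Cc. \<forall>\<theta>\<in>Cc. g (\<lambda>u. \<phi> u + \<theta> u) = (\<lambda>u. g \<phi> u + g \<theta> u)) \<and>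
                  (\<forall>c. \<forall>\<phi>\<in>Cc. g (\<lambda>u. c * \<phi> u) = (\<lambda>u. c * g \<phi> u))}\<rparr>"

section \<open>The construction of Weil\<close>

definition AW :: "('w \<times> 'r) monoid" where
  "AW = \<lparr>carrier = {(w, r). r \<noteq> 0},
        mult = (\<lambda>(w, r) (w', r'). (w + w', r * r' * psi (polB w w'))),
        one = (0, 1)\<rparr>"

definition aut_AW :: "('w \<Rightarrow> 'w) \<Rightarrow> ('w \<Rightarrow> 'r) \<Rightarrow> 'w \<times> 'r \<Rightarrow> 'w \<times> 'r" where
  "aut_AW \<sigma> c = restrict (\<lambda>(w, r). (\<sigma> w, r * c w)) (carrier AW)"

text \<open>The group of automorphisms of \<open>AW\<close> that are trivial on the centre and belong to
  \<open>Sp(W) \<ltimes> W\<^sup>*\<close>. An abstract automorphism of \<open>AW\<close> trivial on the centre need not be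
  \<open>F\<close>-linear modulo the centre, so the second condition is not automatic.\<close>

definition B0 :: "('w \<times> 'r \<Rightarrow> 'w \<times> 'r) monoid" where
  "B0 = (AutoGroup AW)\<lparr>carrier :=
     {\<alpha> \<in> auto AW. (\<forall>r. r \<noteq> 0 \<longrightarrow> \<alpha> (0, r) = (0, r)) \<and>
        (\<exists>\<sigma>\<in>carrier Sp. \<exists>\<tau>\<in>dual. \<alpha> = aut_AW \<sigma> (\<lambda>w. psi (quad \<sigma> w) * psi (\<tau> w)))}\<rparr>"

definition Sp_to_B0 :: "('w \<Rightarrow> 'w) \<Rightarrow> ('w \<times> 'r \<Rightarrow> 'w \<times> 'r)" where
  "Sp_to_B0 \<sigma> = aut_AW \<sigma> (\<lambda>w. psi (quad \<sigma> w))"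

definition U0 :: "'w \<times> 'r \<Rightarrow> ('w \<Rightarrow> 'r) \<Rightarrow> ('w \<Rightarrow> 'r)" where
  "U0 = (\<lambda>(w, r). \<lambda>\<phi>\<in>Cc. \<lambda>u. r * psi (form u (prY w)) * \<phi> (u + prX w))"

definition BB0 :: "(('w \<Rightarrow> 'r) \<Rightarrow> ('w \<Rightarrow> 'r)) monoid" where
  "BB0 = GL_Cc\<lparr>carrier := normalizer GL_Cc (U0 ` carrier AW)\<rparr>"

text \<open>Conjugation by \<open>s\<close> on the image of \<open>U0\<close>, transported to \<open>AW\<close>.\<close>

definition conj0 :: "(('w \<Rightarrow> 'r) \<Rightarrow> ('w \<Rightarrow> 'r)) \<Rightarrow> ('w \<times> 'r \<Rightarrow> 'w \<times> 'r)" where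
  "conj0 s = (\<lambda>a \<in> carrier AW.
     inv_into (carrier AW) U0 (s \<otimes>\<^bsub>GL_Cc\<^esub> U0 a \<otimes>\<^bsub>GL_Cc\<^esub> inv\<^bsub>GL_Cc\<^esub> s))"

definition FP0 :: "(('w \<Rightarrow> 'w) \<times> (('w \<Rightarrow> 'r) \<Rightarrow> ('w \<Rightarrow> 'r))) monoid" where
  "FP0 = fibre_product Sp BB0 Sp_to_B0 conj0"

section \<open>The Heisenberg construction\<close>

definition Heis :: "('w \<times> 'f) monoid" where
  "Heis = \<lparr>carrier = UNIV,
        mult = (\<lambda>(w, t) (w', t'). (w + w', t + t' + form w w' / 2)),
        one = (0, 0)\<rparr>"

definition ker_psi :: "('w \<times> 'f) set" where
  "ker_psi = {(w, t). w = 0 \<and> psi t = 1}"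

text \<open>The law of the semidirect product is the one of composition of the automorphisms
  \<open>act_Heis b\<close> of \<open>Heis\<close>.\<close>

definition B1 :: "(('w \<Rightarrow> 'w) \<times> ('w \<Rightarrow> 'f)) monoid" where
  "B1 = \<lparr>carrier = carrier Sp \<times> dual,
         mult = (\<lambda>(\<sigma>, \<gamma>) (\<sigma>', \<gamma>'). (\<sigma> \<circ> \<sigma>', \<lambda>w. \<gamma>' w + \<gamma> (\<sigma>' w))),
         one = (id, \<lambda>_. 0)\<rparr>"

definition act_Heis :: "('w \<Rightarrow> 'w) \<times> ('w \<Rightarrow> 'f) \<Rightarrow> 'w \<times> 'f \<Rightarrow> 'w \<times> 'f" where
  "act_Heis = (\<lambda>(\<sigma>, \<gamma>) (w, t). (\<sigma> w, t + \<gamma> w))"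

text \<open>The automorphism of \<open>Heis / ker \<psi>\<close> induced by an element of \<open>B1\<close>.\<close>

definition B1_aut :: "('w \<Rightarrow> 'w) \<times> ('w \<Rightarrow> 'f) \<Rightarrow> ('w \<times> 'f) set \<Rightarrow> ('w \<times> 'f) set" where
  "B1_aut b = (\<lambda>C \<in> carrier (Heis Mod ker_psi). act_Heis b ` C)"

definition Sp_to_B1 :: "('w \<Rightarrow> 'w) \<Rightarrow> ('w \<Rightarrow> 'w) \<times> ('w \<Rightarrow> 'f)" where
  "Sp_to_B1 \<sigma> = (\<sigma>, \<lambda>_. 0)"

definition U1 :: "'w \<times> 'f \<Rightarrow> ('w \<Rightarrow> 'r) \<Rightarrow> ('w \<Rightarrow> 'r)" where
  "U1 = (\<lambda>(w, t). \<lambda>\<phi>\<in>Cc. \<lambda>u.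
     psi t * psi (form (prX w) (prY w) / 2) * psi (form u (prY w)) * \<phi> (u + prX w))"

definition U1_quot :: "('w \<times> 'f) set \<Rightarrow> ('w \<Rightarrow> 'r) \<Rightarrow> ('w \<Rightarrow> 'r)" where
  "U1_quot C = the_elem (U1 ` C)"

definition BB1 :: "(('w \<Rightarrow> 'r) \<Rightarrow> ('w \<Rightarrow> 'r)) monoid" where
  "BB1 = GL_Cc\<lparr>carrier := normalizer GL_Cc (U1 ` carrier Heis)\<rparr>"

text \<open>Conjugation by \<open>s\<close> on the image of \<open>U1\<close>, transported to \<open>Heis / ker \<psi>\<close>.\<close>

definition conj1 :: "(('w \<Rightarrow> 'r) \<Rightarrow> ('w \<Rightarrow> 'r)) \<Rightarrow> ('w \<times> 'f) set \<Rightarrow> ('w \<times> 'f) set" where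
  "conj1 s = (\<lambda>C \<in> carrier (Heis Mod ker_psi).
     inv_into (carrier (Heis Mod ker_psi)) U1_quot
       (s \<otimes>\<^bsub>GL_Cc\<^esub> U1_quot C \<otimes>\<^bsub>GL_Cc\<^esub> inv\<^bsub>GL_Cc\<^esub> s))"

definition FP1 :: "(('w \<Rightarrow> 'w) \<times> (('w \<Rightarrow> 'r) \<Rightarrow> ('w \<Rightarrow> 'r))) monoid" where
  "FP1 = fibre_product Sp BB1 (\<lambda>\<sigma>. B1_aut (Sp_to_B1 \<sigma>)) conj1"

section \<open>The comparison map\<close>

definition B1_to_B0 :: "('w \<Rightarrow> 'w) \<times> ('w \<Rightarrow> 'f) \<Rightarrow> ('w \<times> 'r \<Rightarrow> 'w \<times> 'r)" where
  "B1_to_B0 = (\<lambda>(\<sigma>, \<gamma>). aut_AW \<sigma> (\<lambda>w. psi (\<gamma> w) * psi (quad \<sigma> w)))"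

end

end

theory Submission
  imports Defs "HOL-Computational_Algebra.Polynomial" "HOL-Computational_Algebra.Primes"
begin

text \<open>
  Since \<open>U1 (w, t) = U0 (w, psi (t + polB w w / 2))\<close>, the group \<open>U0(A)\<close> is generated by
  \<open>U1(H)\<close> and the scalars, and conjugation by an operator \<open>s\<close> is given on \<open>U0\<close> and on \<open>U1\<close> by
  formulas that correspond under \<open>B1 \<rightarrow> B0\<close>.

  What needs an argument is that an operator \<open>s\<close> normalizing \<open>U0(A)\<close> normalizes \<open>U1(H)\<close>. A priori,
  \<open>s U1(w) s\<inverse> = r U1(w')\<close> with \<open>r\<close> a scalar, and hence \<open>s U1(kw) s\<inverse> = r\<^sup>k U1(kw')\<close> for every
  natural number \<open>k\<close>. For \<open>k = p\<^sup>n\<close> with \<open>n\<close> large, both sides act trivially on suitable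
  functions and points, the representation being smooth, so \<open>r\<close> is a root of unity of
  \<open>p\<close>-power order, of order dividing \<open>p\<close> if \<open>p = 0\<close> in \<open>F\<close>. Such roots of unity are values
  of \<open>psi\<close>.
\<close>

section \<open>Ultrametric absolute values\<close>

text \<open>General enough to include the trivial absolute value of a finite field, so that finite
  and local base fields are treated at once.\<close>

locale ultrametric_field =
  fixes v :: "'f::field \<Rightarrow> real"
  assumes v_nonneg: "0 \<le> v x"
    and v_eq_0_iff: "v x = 0 \<longleftrightarrow> x = 0"
    and v_mult: "v (x * y) = v x * v y"
    and v_ultrametric: "v (x + y) \<le> max (v x) (v y)"
    and v_locally_compact: "locally_compact_space (Metric_space.mtopology UNIV (\<lambda>x y. v (x - y)))"
begin

lemma v_one: "v 1 = 1"
  using v_mult[of 1 1] v_eq_0_iff[of 1] by simp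

lemma v_minus: "v (- x) = v x"
proof -
  have "v (-1) * v (-1) = 1"
    using v_mult[of "-1" "-1"] v_one by simp
  then have "v (-1) = 1"
    using v_nonneg[of "-1"] by (metis abs_of_nonneg abs_square_eq_1 power2_eq_square)
  then show ?thesis
    using v_mult[of "-1" x] by simp
qed

lemma v_diff: "v (x - y) \<le> max (v x) (v y)"
  using v_ultrametric[of x "- y"] by (simp add: v_minus)

lemma v_power: "v (x ^ n) = v x ^ n"
  by (induction n) (simp_all add: v_one v_mult)

sublocale Metric_space UNIV "\<lambda>x y. v (x - y)"
proof
  fix x y z
  show "v (x - y) = v (y - x)"
    using v_minus[of "x - y"] by simp
  show "v (x - z) \<le> v (x - y) + v (y - z)"
    using v_ultrametric[of "x - y" "y - z"] v_nonneg[of "x - y"] v_nonneg[of "y - z"] by (simp add: max_def split: if_splits)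
qed (auto simp: v_nonneg v_eq_0_iff)

text \<open>By the ultrametric inequality a ball about 0 is a subgroup, and an open subgroup is
  closed. A ball that lies inside a compact neighbourhood of 0 is therefore compact.\<close>

lemma compact_open_subgroup:
  assumes "openin mtopology U" "0 \<in> U"
  shows "\<exists>V \<subseteq> U. openin mtopology V \<and> compactin mtopology V \<and> 0 \<in> V \<and> (\<forall>a\<in>V. \<forall>b\<in>V. a - b \<in> V)"
proof -
  obtain W K where W: "openin mtopology W" "compactin mtopology K" "0 \<in> W" "W \<subseteq> K"
    using v_locally_compact unfolding locally_compact_space_def by (metis UNIV_I topspace_mtopology)
  then have "openin mtopology (U \<inter> W)" "0 \<in> U \<inter> W"
    using assms by auto
  then obtain r where r: "r > 0" "mball 0 r \<subseteq> U \<inter> W"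
    by (metis openin_mtopology)
  define V where "V = mball 0 r"
  have V: "a \<in> V \<longleftrightarrow> v a < r" for a
    using v_minus[of a] by (simp add: V_def)
  have diff: "a - b \<in> V" if "a \<in> V" "b \<in> V" for a b
    using that v_diff[of a b] by (simp add: V)
  have "closedin mtopology V"
    unfolding closedin_metric
  proof (intro conjI allI impI)
    fix x assume x: "x \<in> UNIV - V"
    \<comment> \<open>A point \<open>y\<close> of \<open>V\<close> within distance \<open>r\<close>
      of \<open>x\<close> would put \<open>x = (x - y) - (0 - y)\<close> into the subgroup
      \<open>V\<close>.\<close>
    have "y \<notin> V" if "y \<in> mball x r" for y
    proof
      assume "y \<in> V"
      moreover have "x - y \<in> V"
        using that by (simp add: V)
      ultimately have "(x - y) - (0 - y) \<in> V"
        using diff[of 0 y] diff[of "x - y" "0 - y"] r by (simp add: V v_eq_0_iff[of 0, simplified])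
      then show False using x by simp
    qed
    then show "\<exists>e>0. disjnt V (mball x e)"
      using r(1) by (force simp: disjnt_def)
  qed simp
  then have "compactin mtopology V"
    using closed_compactin W r(2) unfolding V_def by (metis inf.boundedE order_trans)
  moreover have "openin mtopology V"
    by (simp add: V_def)
  ultimately show ?thesis
    using r diff by (intro exI[of _ V]) (auto simp: V_def[symmetric] V v_eq_0_iff[of 0, simplified])
qed

lemma continuous_affine: "continuous_map mtopology mtopology (\<lambda>a. c * a + d)"
proof (unfold metric_continuous_map[OF Metric_space_axioms], intro conjI ballI allI impI)
  fix a and e :: real
  assume e: "e > 0"
  \<comment> \<open>The summand 1 in the denominator keeps the radius positive when
    \<open>c = 0\<close>.\<close>
  have "v (c * a + d - (c * x + d)) < e" if "v (a - x) < e / (v c + 1)" for x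
  proof -
    have "v (c * a + d - (c * x + d)) = v c * v (a - x)"
      by (simp flip: v_mult add: algebra_simps)
    also have "\<dots> \<le> (v c + 1) * v (a - x)"
      by (intro mult_right_mono) (auto simp: v_nonneg)
    also have "\<dots> < e"
      using that v_nonneg[of c] pos_less_divide_eq[of "v c + 1" "v (a - x)" e] by (simp add: mult.commute)
    finally show ?thesis .
  qed
  then show "\<exists>\<delta>>0. \<forall>x. x \<in> UNIV \<and> v (a - x) < \<delta> \<longrightarrow> v (c * a + d - (c * x + d)) < e"
    using e v_nonneg[of c] by (intro exI[of _ "e / (v c + 1)"]) auto
qed simp

lemma separation:
  assumes "a \<noteq> 0"
  shows "\<exists>U. openin mtopology U \<and> 0 \<in> U \<and> a \<notin> U"
  using assms v_nonneg[of a] by (intro exI[of _ "mball 0 (v a)"]) (auto simp: v_minus v_eq_0_iff[of a] v_eq_0_iff[of 0, simplified] less_le)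

lemma power_eventually_in:
  assumes "v a < 1" "openin mtopology U" "0 \<in> U"
  shows "\<exists>N. \<forall>n\<ge>N. a ^ n \<in> U"
proof -
  obtain r where r: "r > 0" "mball 0 r \<subseteq> U"
    using assms by (metis openin_mtopology)
  have "(\<lambda>n. v a ^ n) \<longlonglongrightarrow> 0"
    using assms(1) v_nonneg[of a] by (intro LIMSEQ_power_zero) simp
  then have "\<forall>\<^sub>F n in sequentially. v a ^ n < r"
    using r(1) by (rule order_tendstoD)
  then show ?thesis
    using r(2) by (force simp: eventually_sequentially v_power v_minus)
qed

end

section \<open>Preliminaries on groups and locally constant functions\<close>

text \<open>Equality of \<open>H\<close> with its conjugate splits into two inclusions. The second
  is phrased as the first for \<open>inv g\<close>, whence the double inverse, so that one statement
  about conjugation can be applied to an element and to its inverse.\<close>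

lemma (in group) mem_normalizer_iff:
  assumes "H \<subseteq> carrier G"
  shows "g \<in> normalizer G H \<longleftrightarrow>
    g \<in> carrier G \<and> (\<forall>h\<in>H. g \<otimes> h \<otimes> inv g \<in> H) \<and> (\<forall>h\<in>H. inv g \<otimes> h \<otimes> inv (inv g) \<in> H)"
proof (cases "g \<in> carrier G")
  case True
  have "g <# H #> inv g = (\<lambda>h. g \<otimes> h \<otimes> inv g) ` H"
    by (auto simp: l_coset_def r_coset_def)
  moreover have "H \<subseteq> (\<lambda>h. g \<otimes> h \<otimes> inv g) ` H \<longleftrightarrow> (\<forall>h\<in>H. inv g \<otimes> h \<otimes> g \<in> H)"
  proof
    assume *: "H \<subseteq> (\<lambda>h. g \<otimes> h \<otimes> inv g) ` H"
    show "\<forall>h\<in>H. inv g \<otimes> h \<otimes> g \<in> H"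
    proof
      fix h assume "h \<in> H"
      then obtain k where k: "k \<in> H" "h = g \<otimes> k \<otimes> inv g" using * by blast
      then have "k \<in> carrier G" using assms by blast
      then have "inv g \<otimes> h \<otimes> g = k"
        using True by (simp add: k(2) m_assoc) (simp flip: m_assoc)
      then show "inv g \<otimes> h \<otimes> g \<in> H" using k by simp
    qed
  next
    assume *: "\<forall>h\<in>H. inv g \<otimes> h \<otimes> g \<in> H"
    show "H \<subseteq> (\<lambda>h. g \<otimes> h \<otimes> inv g) ` H"
    proof
      fix h assume h: "h \<in> H"
      then have "h \<in> carrier G" using assms by blast
      then have "h = g \<otimes> (inv g \<otimes> h \<otimes> g) \<otimes> inv g"
        using True by (simp add: m_assoc) (simp flip: m_assoc)
      then show "h \<in> (\<lambda>h. g \<otimes> h \<otimes> inv g) ` H" using * h by blast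
    qed
  qed
  ultimately show ?thesis
    using True assms by (auto simp: normalizer_def stabilizer_def)
qed (simp add: normalizer_def stabilizer_def)

lemma locally_constant_onE:
  assumes "locally_constant_on T f" "x \<in> topspace T"
  obtains U where "openin T U" "x \<in> U" "\<forall>y\<in>U. f y = f x"
  using assms unfolding locally_constant_on_def by metis

lemma locally_constant_onI:
  assumes "\<And>x. x \<in> topspace T \<Longrightarrow> \<exists>U. openin T U \<and> x \<in> U \<and> (\<forall>y\<in>U. f y = f x)"
  shows "locally_constant_on T f"
  using assms unfolding locally_constant_on_def by metis

lemma locally_constant_on_cong:
  assumes eq: "\<And>x. x \<in> topspace T \<Longrightarrow> f x = g x" and g: "locally_constant_on T g"
  shows "locally_constant_on T f"
proof (rule locally_constant_onI)
  fix x assume x: "x \<in> topspace T"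
  obtain U where U: "openin T U" "x \<in> U" "\<forall>y\<in>U. g y = g x"
    using g x by (rule locally_constant_onE)
  have "f y = f x" if "y \<in> U" for y
    using U(3)[rule_format, OF that] eq[OF x] eq[of y] openin_subset[OF U(1)] that by auto
  with U(1,2) show "\<exists>U. openin T U \<and> x \<in> U \<and> (\<forall>y\<in>U. f y = f x)" by blast
qed

lemma locally_constant_on_const: "locally_constant_on T (\<lambda>_. c)"
  unfolding locally_constant_on_def using openin_topspace by blast

lemma locally_constant_on_comp2:
  assumes f: "locally_constant_on T f" and g: "locally_constant_on T g"
  shows "locally_constant_on T (\<lambda>x. h (f x) (g x))"
proof (rule locally_constant_onI)
  fix x assume x: "x \<in> topspace T"
  obtain U where U: "openin T U" "x \<in> U" "\<forall>y\<in>U. f y = f x"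
    using f x by (rule locally_constant_onE)
  obtain U' where U': "openin T U'" "x \<in> U'" "\<forall>y\<in>U'. g y = g x"
    using g x by (rule locally_constant_onE)
  have "h (f y) (g y) = h (f x) (g x)" if "y \<in> U \<inter> U'" for y
    using that U(3)[rule_format, of y] U'(3)[rule_format, of y] by simp
  then show "\<exists>U. openin T U \<and> x \<in> U \<and> (\<forall>y\<in>U. h (f y) (g y) = h (f x) (g x))"
    using U(1,2) U'(1,2) by (intro exI[of _ "U \<inter> U'"]) blast
qed

lemma locally_constant_on_mult:
  "locally_constant_on T f \<Longrightarrow> locally_constant_on T g \<Longrightarrow> locally_constant_on T (\<lambda>x. f x * g x)"
  by (rule locally_constant_on_comp2)

lemma locally_constant_on_compose:
  assumes h: "continuous_map S T h" and f: "locally_constant_on T f"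
  shows "locally_constant_on S (\<lambda>x. f (h x))"
proof (rule locally_constant_onI)
  fix x assume x: "x \<in> topspace S"
  then have "h x \<in> topspace T"
    using h continuous_map_image_subset_topspace by fastforce
  with f obtain U where U: "openin T U" "h x \<in> U" "\<forall>y\<in>U. f y = f (h x)"
    by (rule locally_constant_onE)
  then show "\<exists>U. openin S U \<and> x \<in> U \<and> (\<forall>y\<in>U. f (h y) = f (h x))"
    using x openin_continuous_map_preimage[OF h U(1)]
    by (intro exI[of _ "{x \<in> topspace S. h x \<in> U}"]) blast
qed

text \<open>The zero set of a locally constant function is open. This removes the closure from the
  definition of \<open>Cc\<close>.\<close>

lemma closure_of_support:
  assumes "locally_constant_on T (\<phi> :: 'a \<Rightarrow> 'b::zero)"
  shows "T closure_of {u \<in> topspace T. \<phi> u \<noteq> 0} = {u \<in> topspace T. \<phi> u \<noteq> 0}"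
proof -
  have "\<exists>U. openin T U \<and> u \<in> U \<and> U \<subseteq> {u \<in> topspace T. \<phi> u = 0}" if "u \<in> topspace T" "\<phi> u = 0" for u
  proof -
    obtain U where U: "openin T U" "u \<in> U" "\<forall>y\<in>U. \<phi> y = \<phi> u"
      using assms \<open>u \<in> topspace T\<close> by (rule locally_constant_onE)
    have "y \<in> topspace T \<and> \<phi> y = 0" if "y \<in> U" for y
      using openin_subset[OF U(1)] U(3)[rule_format, OF that] that \<open>\<phi> u = 0\<close> by auto
    then show ?thesis
      using U(1,2) by (intro exI[of _ U]) blast
  qed
  then have "openin T {u \<in> topspace T. \<phi> u = 0}"
    by (subst openin_subopen) blast
  moreover have "topspace T - {u \<in> topspace T. \<phi> u \<noteq> 0} = {u \<in> topspace T. \<phi> u = 0}"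
    by auto
  ultimately show ?thesis
    by (simp add: closure_of_closedin closedin_def)
qed

lemma inv_into_eq_iff:
  assumes "inj_on f A" "y \<in> f ` A" "x \<in> A"
  shows "inv_into A f y = x \<longleftrightarrow> y = f x"
  using assms by (metis f_inv_into_f inv_into_f_f)

lemma restrict_eq_restrict_iff: "restrict f A = restrict g A \<longleftrightarrow> (\<forall>x\<in>A. f x = g x)"
  by (metis restrict_apply restrict_ext)

section \<open>The field, the character and the symplectic space\<close>

text \<open>A finite field gets the trivial absolute value, which induces the discrete topology and
  vanishes at \<open>p\<close> because \<open>p = 0\<close> there. In the local case
  \<open>p\<close> has value below 1 by the condition on the residue field.\<close>

lemma (in weil_setting) ultrametric_valuation:
  "\<exists>v. ultrametric_field v \<and> TF = Metric_space.mtopology UNIV (\<lambda>x y. v (x - y)) \<and> v (of_nat p) < 1"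
  using finite_or_local unfolding finite_or_local_field_def
proof (elim conjE disjE exE)
  fix v :: "'f \<Rightarrow> real"
  assume "nonarch_local_field v" and "TF = Metric_space.mtopology UNIV (\<lambda>x y. v (x - y))"
    and "\<forall>n. (v (of_nat n) < 1) = (p dvd n)"
  then show ?thesis
    by (intro exI[of _ v]) (simp add: ultrametric_field_def nonarch_local_field_def)
next
  define v :: "'f \<Rightarrow> real" where "v x = (if x = 0 then 0 else 1)" for x
  assume fin: "finite (UNIV :: 'f set)" and T: "TF = discrete_topology UNIV" and char: "CHAR('f) = p"
  interpret M: Metric_space UNIV "\<lambda>x y. v (x - y)"
    by unfold_locales (auto simp: v_def)
  have "openin M.mtopology {x}" for x
    unfolding M.openin_mtopology by (auto simp: M.mball_def simp flip: v_def intro!: exI[of _ 1]) (simp add: v_def split: if_splits)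
  then have *: "M.mtopology = TF"
    unfolding T by (metis M.topspace_mtopology UNIV_I discrete_topology_unique)
  then have "ultrametric_field v"
    by (auto simp: ultrametric_field_def v_def T locally_compact_space_discrete_topology)
  moreover have "v (of_nat p) < 1"
    using char by (auto simp: v_def)
  ultimately show ?thesis
    using * by (intro exI[of _ v]) auto
qed

context weil_setting
begin

lemma two_neq_0: "(2 :: 'f) \<noteq> 0"
proof
  assume "(2 :: 'f) = 0"
  then have "CHAR('f) dvd 2"
    by (metis of_nat_eq_0_iff_char_dvd of_nat_numeral)
  then have "CHAR('f) = 1"
    using char_not_2 by (metis prime_nat_iff two_is_prime_nat)
  then show False by simp
qed

section \<open>The symplectic form and the polarization\<close>

lemma form_add_left: "form (a + b) c = form a c + form b c"
  and form_scale_left: "form (scale k a) c = k * form a c"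
  using form_linear_left[of c] by (auto simp: Vector_Spaces.linear_iff)

lemma form_add_right: "form c (a + b) = form c a + form c b"
  and form_scale_right: "form c (scale k a) = k * form c a"
  using form_linear_right[of c] by (auto simp: Vector_Spaces.linear_iff)

lemma form_zero: "form 0 c = 0" "form c 0 = 0"
  using form_scale_left[of 0] form_scale_right[of _ 0] by (metis mult_zero_left scale_zero_left)+

lemma form_skew: "form a b = - form b a"
  using form_alternating[of "a + b"] form_alternating[of a] form_alternating[of b]
  by (simp add: form_add_left form_add_right eq_neg_iff_add_eq_0 add.commute)

lemma prX_eqI: "x \<in> X \<Longrightarrow> w - x \<in> Y \<Longrightarrow> prX w = x"
  unfolding prX_def using polarization[of w] by blast

lemma prX_in: "prX w \<in> X" and prY_in: "prY w \<in> Y"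
  unfolding prY_def using polarization[of w] prX_eqI by blast+

lemma prX_plus_prY: "prX w + prY w = w"
  by (simp add: prY_def)

lemma prX_add: "prX (w + w') = prX w + prX w'"
  using prX_in[of w] prX_in[of w'] prY_in[of w] prY_in[of w']
    subspace_add[OF Y_subspace, of "prY w" "prY w'"]
  by (intro prX_eqI) (auto simp: subspace_add[OF X_subspace] prY_def algebra_simps)

lemma prX_scale: "prX (scale k w) = scale k (prX w)"
  using subspace_scale[OF Y_subspace prY_in[of w], of k] prX_in
  by (intro prX_eqI) (auto simp: subspace_scale[OF X_subspace] prY_def scale_right_diff_distrib)

lemma prY_add: "prY (w + w') = prY w + prY w'"
  by (simp add: prY_def prX_add)

lemma prY_scale: "prY (scale k w) = scale k (prY w)"
  by (simp add: prY_def prX_scale scale_right_diff_distrib)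

lemma prX_zero: "prX 0 = 0" and prY_zero: "prY 0 = 0"
  using prX_scale[of 0 0] prY_scale[of 0 0] by simp_all

lemma polB_add_left: "polB (a + b) c = polB a c + polB b c"
  and polB_add_right: "polB c (a + b) = polB c a + polB c b"
  and polB_scale_left: "polB (scale k a) c = k * polB a c"
  and polB_scale_right: "polB c (scale k a) = k * polB c a"
  by (simp_all add: polB_def prX_add prY_add prX_scale prY_scale form_add_left form_add_right
      form_scale_left form_scale_right)

lemma polB_zero: "polB 0 w = 0" "polB w 0 = 0"
  by (simp_all add: polB_def prX_zero prY_zero form_zero)

text \<open>Both \<open>X\<close> and \<open>Y\<close> are isotropic, so only the two mixed terms of
  the form survive; skew-symmetry turns one of them into \<open>polB w' w\<close>.\<close>

lemma polB_minus_swap: "polB w w' - polB w' w = form w w'"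
proof -
  have "form (prX w) (prX w') = 0" "form (prY w) (prY w') = 0"
    using X_lagrangian Y_lagrangian prX_in prY_in by blast+
  then have "form (prX w + prY w) (prX w' + prY w') = polB w w' + form (prY w) (prX w')"
    by (simp add: polB_def form_add_left form_add_right)
  then show ?thesis
    using form_skew[of "prY w" "prX w'"] by (simp add: prX_plus_prY polB_def)
qed

text \<open>A vector orthogonal to \<open>X\<close> lies in \<open>X\<close> by maximality, and
  \<open>X\<close> meets \<open>Y\<close> only in 0 because decompositions are unique.\<close>

lemma eq_0_if_orthogonal_to_X:
  assumes "y \<in> Y" "\<And>u. u \<in> X \<Longrightarrow> form u y = 0"
  shows "y = 0"
proof -
  have "y \<in> X"
    using assms(2) form_skew[of y] by (subst X_lagrangian) auto
  then have "prX y = y" "prX y = 0"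
    using assms(1) subspace_0[OF X_subspace] subspace_0[OF Y_subspace] by (auto intro: prX_eqI)
  then show ?thesis by simp
qed

section \<open>The character \<open>psi\<close> and the topology of the field\<close>

lemma psi_0: "psi 0 = 1"
  using psi_add[of 0 0] psi_nonzero[of 0] by simp

lemma psi_minus: "psi (- a) = inverse (psi a)"
  using psi_add[of a "- a"] psi_nonzero[of a] by (simp add: psi_0 field_simps)

lemma psi_diff: "psi (a - b) = psi a / psi b"
  using psi_add[of a "- b"] by (simp add: psi_minus field_simps)

lemma psi_of_nat: "psi (of_nat n * a) = psi a ^ n"
  by (induction n) (simp_all add: psi_0 psi_add distrib_right)

text \<open>For \<open>a\<close> nonzero the multiples of \<open>a\<close> exhaust the field and
  \<open>psi\<close> would be trivial. This is how linear functionals are recovered from their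
  composites with \<open>psi\<close>.\<close>

lemma psi_eq_1_all: "(\<And>k. psi (k * a) = 1) \<Longrightarrow> a = 0"
  using psi_nontrivial by (metis nonzero_eq_divide_eq)

text \<open>The facts about the topology on which the rest relies; the absolute value does not occur
  after this lemma.\<close>

lemma
  shows topspace_TF: "topspace TF = UNIV"
    and TF_compact_open_subgroup:
      "openin TF U \<Longrightarrow> 0 \<in> U \<Longrightarrow>
       \<exists>V\<subseteq>U. openin TF V \<and> compactin TF V \<and> 0 \<in> V \<and> (\<forall>a\<in>V. \<forall>b\<in>V. a - b \<in> V)"
    and TF_continuous_affine: "continuous_map TF TF (\<lambda>a. c * a + d)"
    and TF_separation: "a \<noteq> 0 \<Longrightarrow> \<exists>U. openin TF U \<and> 0 \<in> U \<and> a \<notin> U"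
    and TF_power_p: "openin TF U \<Longrightarrow> 0 \<in> U \<Longrightarrow> \<exists>N. \<forall>n\<ge>N. of_nat (p ^ n) \<in> U"
proof -
  obtain v where v: "ultrametric_field v" "TF = Metric_space.mtopology UNIV (\<lambda>x y. v (x - y))"
    and vp: "v (of_nat p) < 1"
    using ultrametric_valuation by blast
  interpret ultrametric_field v by fact
  show "topspace TF = UNIV" by (simp add: v)
  show "continuous_map TF TF (\<lambda>a. c * a + d)" unfolding v(2) by (rule continuous_affine)
  show "\<exists>V\<subseteq>U. openin TF V \<and> compactin TF V \<and> 0 \<in> V \<and> (\<forall>a\<in>V. \<forall>b\<in>V. a - b \<in> V)"
    if "openin TF U" "0 \<in> U"
    using that compact_open_subgroup unfolding v(2) by blast
  show "\<exists>U. openin TF U \<and> 0 \<in> U \<and> a \<notin> U" if "a \<noteq> 0"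
    using that separation unfolding v(2) by blast
  show "\<exists>N. \<forall>n\<ge>N. of_nat (p ^ n) \<in> U" if "openin TF U" "0 \<in> U"
    using that power_eventually_in[OF vp] unfolding v(2) by simp
qed

lemma openin_TF_affine_preimage:
  assumes "openin TF U" shows "openin TF {a. c * a + d \<in> U}"
  using openin_continuous_map_preimage[OF TF_continuous_affine[of c d] assms] by (simp add: topspace_TF)

lemma psi_trivial_near_0: "\<exists>U. openin TF U \<and> 0 \<in> U \<and> (\<forall>a\<in>U. psi a = 1)"
  using psi_smooth unfolding locally_constant_on_def by (metis UNIV_I psi_0 topspace_TF)

section \<open>Roots of unity among the values of \<open>psi\<close>\<close>

lemma prime_p: "prime p"
  using finite_or_local by (simp add: finite_or_local_field_def)

text \<open>The multiples of \<open>a\<close> by \<open>p ^ n\<close> tend to 0, where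
  \<open>psi\<close> is trivial by smoothness.\<close>

lemma psi_p_power_torsion: "\<exists>n. psi a ^ (p ^ n) = 1"
proof -
  obtain U where U: "openin TF U" "0 \<in> U" "\<forall>a\<in>U. psi a = 1"
    using psi_trivial_near_0 by blast
  then obtain n where "of_nat (p ^ n) \<in> {b. a * b + 0 \<in> U}"
    using TF_power_p[OF openin_TF_affine_preimage[of U a 0]] by auto
  then show ?thesis
    using U(3) by (metis add.right_neutral mem_Collect_eq mult.commute psi_of_nat)
qed

text \<open>Start from a value \<open>psi a\<close> other than 1 and take the least \<open>n\<close>
  for which its power \<open>p ^ n\<close> is 1; the power with exponent one less in
  \<open>p\<close> has order exactly \<open>p\<close> and is again a value of
  \<open>psi\<close>.\<close>

lemma exists_primitive_root_in_psi: "\<exists>a. psi a \<noteq> 1 \<and> psi a ^ p = 1"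
proof -
  obtain a where a: "psi a \<noteq> 1" using psi_nontrivial by blast
  define n where "n = (LEAST n. psi a ^ (p ^ n) = 1)"
  have n: "psi a ^ (p ^ n) = 1"
    unfolding n_def using psi_p_power_torsion by (rule LeastI_ex)
  then obtain m where m: "n = Suc m"
    using a by (cases n) auto
  then have "psi a ^ (p ^ m) \<noteq> 1"
    using not_less_Least[of m "\<lambda>n. psi a ^ (p ^ n) = 1"] by (auto simp: n_def)
  moreover have "(psi a ^ (p ^ m)) ^ p = 1"
    using n by (simp add: m mult.commute flip: power_mult)
  ultimately show ?thesis
    by (metis psi_of_nat)
qed

text \<open>A value of \<open>psi\<close> of order \<open>p\<close> has \<open>p\<close> distinct
  powers. They already fill the roots of the polynomial \<open>monom 1 p - 1\<close>, which has at
  most \<open>p\<close> of them.\<close>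

lemma root_of_unity_in_range_psi:
  assumes "z ^ p = 1" shows "z \<in> range psi"
proof -
  obtain a where a: "psi a \<noteq> 1" "psi a ^ p = 1"
    using exists_primitive_root_in_psi by blast
  have inj: "inj_on (\<lambda>i. psi a ^ i) {..<p}"
  proof (rule linorder_inj_onI')
    fix i j assume ij: "i \<in> {..<p}" "j \<in> {..<p}" "i < j"
    show "psi a ^ i \<noteq> psi a ^ j"
    proof
      assume "psi a ^ i = psi a ^ j"
      then have *: "psi a ^ (j - i) = 1"
        using ij(3) psi_nonzero[of a] by (simp add: power_diff)
      have "\<not> p dvd j - i"
        using ij by (auto dest: dvd_imp_le)
      \<comment> \<open>Since \<open>j - i\<close> is invertible modulo \<open>p\<close>, the
        relation with exponent \<open>j - i\<close> can be raised to a power that gives exponent 1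
        modulo \<open>p\<close>.\<close>
      then obtain x y where xy: "(j - i) * x = Suc (p * y)"
        using bezout_prime[OF prime_p] by blast
      have "1 = (psi a ^ (j - i)) ^ x" using * by simp
      also have "\<dots> = psi a * (psi a ^ p) ^ y"
        by (simp add: xy flip: power_mult)
      finally show False using a by simp
    qed
  qed
  let ?q = "monom 1 p - 1 :: 'r poly"
  have p0: "p > 0" using prime_p prime_gt_0_nat by blast
  have deg: "degree ?q = p"
    using p0 degree_add_eq_left[of "- 1" "monom (1 :: 'r) p"] by (simp add: degree_monom_eq)
  then have q0: "?q \<noteq> 0" using p0 by force
  have roots: "{x. poly ?q x = 0} = {x. x ^ p = 1}"
    by (auto simp: poly_monom)
  have "(\<lambda>i. psi a ^ i) ` {..<p} = {x. x ^ p = 1}"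
  proof (rule card_seteq)
    show "finite {x :: 'r. x ^ p = 1}"
      using poly_roots_finite[OF q0] unfolding roots .
    show "(\<lambda>i. psi a ^ i) ` {..<p} \<subseteq> {x. x ^ p = 1}"
      using a(2) by (auto simp flip: power_mult simp: mult.commute[of _ p]) (simp add: power_mult)
    show "card {x :: 'r. x ^ p = 1} \<le> card ((\<lambda>i. psi a ^ i) ` {..<p})"
      using card_poly_roots_bound[OF q0] unfolding roots by (simp add: deg card_image[OF inj])
  qed
  then show ?thesis
    using assms by (force simp flip: psi_of_nat)
qed

text \<open>Induction on \<open>n\<close>: if \<open>z ^ p\<close> is \<open>psi b\<close>, then
  division of \<open>b\<close> by \<open>p\<close> gives a value of \<open>psi\<close> with the same
  \<open>p\<close>-th power as \<open>z\<close>, and the quotient is a \<open>p\<close>-th root of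
  unity.\<close>

lemma p_power_root_of_unity_in_range_psi:
  assumes "(of_nat p :: 'f) \<noteq> 0"
  shows "z ^ (p ^ n) = 1 \<Longrightarrow> z \<in> range psi"
proof (induction n arbitrary: z)
  case 0
  then show ?case using psi_0 by (metis power_0 power_one_right rangeI)
next
  case (Suc n)
  then have "z ^ p \<in> range psi"
    by (simp add: power_mult)
  then obtain b where "z ^ p = psi (of_nat p * (b / of_nat p))"
    using assms by auto
  then have "(z / psi (b / of_nat p)) ^ p = 1"
    using psi_nonzero by (simp add: psi_of_nat power_divide del: times_divide_eq_right)
  then obtain c where "z / psi (b / of_nat p) = psi c"
    using root_of_unity_in_range_psi by blast
  then have "z = psi (c + b / of_nat p)"
    using psi_nonzero by (simp add: psi_add field_simps)
  then show ?case by blast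
qed

section \<open>The topology of \<open>X\<close>\<close>

lemma X_basis: "independent X_basis" "span X_basis = X" "finite X_basis"
proof -
  obtain B where "B \<subseteq> X" "independent B" "X \<subseteq> span B"
    using maximal_independent_subset .
  then have "\<exists>B. independent B \<and> span B = X"
    using X_subspace span_minimal by blast
  then have *: "independent X_basis \<and> span X_basis = X"
    unfolding X_basis_def by (rule someI_ex)
  then show "independent X_basis" "span X_basis = X" by auto
  obtain B where "finite_dimensional_vector_space scale B"
    using finite_dim by blast
  then interpret fd: finite_dimensional_vector_space scale B .
  show "finite X_basis" using * fd.finiteI_independent by blast
qed

abbreviation coord :: "'w \<Rightarrow> 'w \<Rightarrow> 'f" where
  "coord \<equiv> representation X_basis"

lemma coord_add: "u \<in> X \<Longrightarrow> u' \<in> X \<Longrightarrow> coord (u + u') b = coord u b + coord u' b"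
  by (simp add: representation_add X_basis)

lemma coord_scale: "u \<in> X \<Longrightarrow> coord (scale k u) b = k * coord u b"
  by (simp add: representation_scale X_basis)

lemma sum_coord: "u \<in> X \<Longrightarrow> (\<Sum>b\<in>X_basis. scale (coord u b) b) = u"
  by (rule sum_representation_eq) (auto simp: X_basis)

lemma coord_sum:
  assumes "b \<in> X_basis"
  shows "coord (\<Sum>b\<in>X_basis. scale (f b) b) b = f b"
proof -
  have "coord (\<Sum>b\<in>X_basis. scale (f b) b) b = (\<Sum>b'\<in>X_basis. f b' * coord b' b)"
    by (simp add: representation_sum representation_scale X_basis(1) span_base span_scale)
  also have "\<dots> = (\<Sum>b'\<in>X_basis. if b' = b then f b' else 0)"
    by (intro sum.cong) (simp_all add: representation_basis X_basis(1))
  finally show ?thesis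
    using assms by (simp add: X_basis(3))
qed

lemma coord_eq_0_imp:
  assumes "u \<in> X" "\<And>b. b \<in> X_basis \<Longrightarrow> coord u b = 0"
  shows "u = 0"
  using sum_coord[OF assms(1)] assms(2) by simp

lemma topspace_TX: "topspace TX = X"
  by (auto simp: TX_def topspace_pullback_topology topspace_TF)

lemma continuous_coord:
  assumes "b \<in> X_basis" shows "continuous_map TX TF (\<lambda>u. coord u b)"
proof -
  have "continuous_map TX TF ((\<lambda>f. f b) \<circ> (\<lambda>u. restrict (coord u) X_basis))"
    unfolding TX_def using assms by (intro continuous_map_pullback continuous_map_product_projection)
  then show ?thesis
    using assms by (simp add: o_def)
qed

lemma continuous_map_into_TX:
  assumes "\<And>x. x \<in> topspace T \<Longrightarrow> g x \<in> X"
    and "\<And>b. b \<in> X_basis \<Longrightarrow> continuous_map T TF (\<lambda>x. coord (g x) b)"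
  shows "continuous_map T TX g"
  unfolding TX_def
proof (rule continuous_map_pullback')
  show "continuous_map T (product_topology (\<lambda>_. TF) X_basis) ((\<lambda>u. restrict (coord u) X_basis) \<circ> g)"
    using assms(2) by (auto simp: continuous_map_componentwise)
qed (use assms in auto)

lemma continuous_translation:
  assumes "x \<in> X" shows "continuous_map TX TX (\<lambda>u. u + x)"
proof (rule continuous_map_into_TX)
  fix b assume b: "b \<in> X_basis"
  have "continuous_map TX TF (\<lambda>u. coord u b + coord x b)"
    using continuous_map_compose[OF continuous_coord[OF b] TF_continuous_affine[of 1 "coord x b"]]
    by (simp add: o_def)
  then show "continuous_map TX TF (\<lambda>u. coord (u + x) b)"
    using assms by (auto simp: topspace_TX coord_add intro: continuous_map_eq)
qed (use assms X_subspace in \<open>auto simp: topspace_TX subspace_add\<close>)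

lemma continuous_line:
  assumes "u \<in> X" "x \<in> X" shows "continuous_map TF TX (\<lambda>a. u + scale a x)"
proof (rule continuous_map_into_TX)
  fix b
  show "continuous_map TF TF (\<lambda>a. coord (u + scale a x) b)"
    using TF_continuous_affine[of "coord x b" "coord u b"] assms X_subspace
    by (simp add: coord_add coord_scale subspace_scale add.commute mult.commute)
qed (use assms X_subspace in \<open>auto simp: subspace_add subspace_scale\<close>)

text \<open>The box with side \<open>V\<close> in the coordinates of \<open>X_basis\<close>. For a
  compact open subgroup \<open>V\<close> it is a compact open subgroup of \<open>X\<close>, and its
  indicator serves as the basic element of \<open>Cc\<close>.\<close>

definition lattice :: "'f set \<Rightarrow> 'w set" where
  "lattice V = {u \<in> X. \<forall>b\<in>X_basis. coord u b \<in> V}"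

text \<open>A box with open sides is open in the product topology because \<open>X_basis\<close> is
  finite.\<close>

lemma openin_lattice:
  assumes "openin TF V" shows "openin TX (lattice V)"
  unfolding TX_def openin_pullback_topology
proof (intro exI conjI)
  show "openin (product_topology (\<lambda>_. TF) X_basis) (\<Pi>\<^sub>E b\<in>X_basis. V)"
    using assms by (simp add: openin_PiE X_basis(3))
qed (auto simp: lattice_def PiE_iff)

text \<open>By Tychonoff's theorem the box is compact in the product; the map rebuilding a vector
  from its coordinates is continuous and carries the box onto the lattice.\<close>

lemma compactin_lattice:
  assumes "compactin TF V" shows "compactin TX (lattice V)"
proof -
  let ?P = "product_topology (\<lambda>_. TF) X_basis" and ?\<iota> = "\<lambda>f. \<Sum>b\<in>X_basis. scale (f b) b"
  have in_X: "?\<iota> f \<in> X" for f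
    using X_subspace X_basis(2) span_base by (intro subspace_sum subspace_scale) auto
  have "continuous_map ?P TX ?\<iota>"
    using in_X continuous_map_product_projection[of _ X_basis "\<lambda>_. TF"]
    by (intro continuous_map_into_TX) (simp_all add: coord_sum)
  moreover have "compactin ?P (\<Pi>\<^sub>E b\<in>X_basis. V)"
    using assms by (simp add: compactin_PiE)
  ultimately have "compactin TX (?\<iota> ` (\<Pi>\<^sub>E b\<in>X_basis. V))"
    using image_compactin by blast
  moreover have "?\<iota> ` (\<Pi>\<^sub>E b\<in>X_basis. V) = lattice V"
  proof
    show "?\<iota> ` (\<Pi>\<^sub>E b\<in>X_basis. V) \<subseteq> lattice V"
      using in_X by (auto simp: lattice_def coord_sum)
    show "lattice V \<subseteq> ?\<iota> ` (\<Pi>\<^sub>E b\<in>X_basis. V)"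
    proof
      fix u assume u: "u \<in> lattice V"
      then have "u = ?\<iota> (restrict (coord u) X_basis)"
        by (simp add: lattice_def sum_coord)
      moreover have "restrict (coord u) X_basis \<in> (\<Pi>\<^sub>E b\<in>X_basis. V)"
        using u by (auto simp: lattice_def)
      ultimately show "u \<in> ?\<iota> ` (\<Pi>\<^sub>E b\<in>X_basis. V)" by blast
    qed
  qed
  ultimately show ?thesis by simp
qed

lemma form_coord: "u \<in> X \<Longrightarrow> form u w = (\<Sum>b\<in>X_basis. coord u b * form b w)"
proof -
  assume u: "u \<in> X"
  have "form (\<Sum>b\<in>B. scale (coord u b) b) w = (\<Sum>b\<in>B. coord u b * form b w)" if "finite B" for B
    using that by (induction B) (simp_all add: form_zero form_add_left form_scale_left)
  from this[OF X_basis(3)] show ?thesis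
    unfolding sum_coord[OF u] .
qed

lemma psi_sum: "psi (\<Sum>i\<in>I. f i) = (\<Prod>i\<in>I. psi (f i))"
  by (induction I rule: infinite_finite_induct) (simp_all add: psi_0 psi_add)

text \<open>In coordinates the character is a finite product of factors, each of which is
  \<open>psi\<close> after a linear function of a single coordinate.\<close>

lemma locally_constant_character: "locally_constant_on TX (\<lambda>u. psi (form u w))"
proof -
  have "locally_constant_on TX (\<lambda>u. \<Prod>b\<in>B. psi (coord u b * form b w))" if "finite B" "B \<subseteq> X_basis" for B
    using that
  proof (induction B)
    case empty
    then show ?case by (auto simp: locally_constant_on_def)
  next
    case (insert b B)
    have "continuous_map TX TF (\<lambda>u. form b w * coord u b + 0)"
      using continuous_map_compose[OF continuous_coord TF_continuous_affine[of _ 0], of b] insert.prems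
      by (simp add: o_def)
    then have "locally_constant_on TX (\<lambda>u. psi (form b w * coord u b + 0))"
      using psi_smooth locally_constant_on_compose by blast
    then show ?case
      using insert by (simp add: mult.commute locally_constant_on_mult)
  qed
  from this[OF X_basis(3) order_refl]
  have *: "locally_constant_on TX (\<lambda>u. \<Prod>b\<in>X_basis. psi (coord u b * form b w))" .
  show ?thesis
  proof (rule locally_constant_on_cong[OF _ *])
    show "psi (form u w) = (\<Prod>b\<in>X_basis. psi (coord u b * form b w))" if "u \<in> topspace TX" for u
      using that by (simp add: topspace_TX form_coord psi_sum)
  qed
qed

lemma mem_Cc_iff:
  "\<phi> \<in> Cc \<longleftrightarrow> (\<forall>u. u \<notin> X \<longrightarrow> \<phi> u = 0) \<and> locally_constant_on TX \<phi> \<and> compactin TX {u \<in> X. \<phi> u \<noteq> 0}"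
  using closure_of_support[of TX \<phi>] by (auto simp: Cc_def topspace_TX)

section \<open>Operators on smooth compactly supported functions\<close>

lemma Cc_add:
  assumes "\<phi> \<in> Cc" "\<theta> \<in> Cc"
  shows "(\<lambda>u. \<phi> u + \<theta> u) \<in> Cc"
  unfolding mem_Cc_iff
proof (intro conjI)
  show lc: "locally_constant_on TX (\<lambda>u. \<phi> u + \<theta> u)"
    using assms by (intro locally_constant_on_comp2[where h = "(+)"]) (simp_all add: mem_Cc_iff)
  \<comment> \<open>The support of the sum is a closed subset of this compact union.\<close>
  have cpt: "compactin TX ({u \<in> X. \<phi> u \<noteq> 0} \<union> {u \<in> X. \<theta> u \<noteq> 0})"
    using assms by (intro compactin_Un) (auto simp: mem_Cc_iff)
  have "closedin TX {u \<in> X. \<phi> u + \<theta> u \<noteq> 0}"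
    using closure_of_support[OF lc] closedin_closure_of[of TX "{u \<in> X. \<phi> u + \<theta> u \<noteq> 0}"]
    unfolding topspace_TX by simp
  then show "compactin TX {u \<in> X. \<phi> u + \<theta> u \<noteq> 0}"
    by (intro closed_compactin[OF cpt]) auto
qed (use assms in \<open>auto simp: mem_Cc_iff\<close>)

lemma Cc_scale:
  assumes "\<phi> \<in> Cc" shows "(\<lambda>u. c * \<phi> u) \<in> Cc"
proof -
  have "locally_constant_on TX (\<lambda>u. c * \<phi> u)"
    using assms by (intro locally_constant_on_mult locally_constant_on_const) (simp add: mem_Cc_iff)
  moreover have "{u \<in> X. c * \<phi> u \<noteq> 0} = (if c = 0 then {} else {u \<in> X. \<phi> u \<noteq> 0})"
    by auto
  ultimately show ?thesis
    using assms by (auto simp: mem_Cc_iff)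
qed

lemma add_mem_X_iff: "x \<in> X \<Longrightarrow> u + x \<in> X \<longleftrightarrow> u \<in> X"
  using subspace_diff[OF X_subspace, of "u + x" x] subspace_add[OF X_subspace] by auto

lemma Cc_translate:
  assumes "\<phi> \<in> Cc" "x \<in> X" shows "(\<lambda>u. \<phi> (u + x)) \<in> Cc"
  unfolding mem_Cc_iff
proof (intro conjI)
  show "locally_constant_on TX (\<lambda>u. \<phi> (u + x))"
    using assms locally_constant_on_compose[OF continuous_translation] by (auto simp: mem_Cc_iff)
  have mx: "- x \<in> X" using assms(2) X_subspace subspace_neg by blast
  have "compactin TX ((\<lambda>u. u + - x) ` {u \<in> X. \<phi> u \<noteq> 0})"
    using assms image_compactin[OF _ continuous_translation[OF mx]] by (simp add: mem_Cc_iff)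
  moreover have "(\<lambda>u. u + - x) ` {u \<in> X. \<phi> u \<noteq> 0} = {u \<in> X. \<phi> (u + x) \<noteq> 0}"
  proof safe
    fix u assume "u \<in> X" "\<phi> u \<noteq> 0"
    then show "u + - x \<in> X" "\<phi> (u + - x + x) = 0 \<Longrightarrow> False"
      using add_mem_X_iff[OF mx] by simp_all
  next
    fix u assume "u \<in> X" "\<phi> (u + x) \<noteq> 0"
    then show "u \<in> (\<lambda>u. u + - x) ` {u \<in> X. \<phi> u \<noteq> 0}"
      using add_mem_X_iff[OF assms(2)] by (intro image_eqI[of _ _ "u + x"]) simp_all
  qed
  ultimately show "compactin TX {u \<in> X. \<phi> (u + x) \<noteq> 0}" by simp
qed (use assms in \<open>auto simp: mem_Cc_iff add_mem_X_iff\<close>)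

lemma Cc_character_mult:
  assumes "\<phi> \<in> Cc" shows "(\<lambda>u. psi (form u y) * \<phi> u) \<in> Cc"
  using assms locally_constant_on_mult[OF locally_constant_character]
  by (auto simp: mem_Cc_iff psi_nonzero)

lemma lattice_add_mem_iff:
  assumes V: "0 \<in> V" "\<forall>a\<in>V. \<forall>b\<in>V. a - b \<in> V" and u': "u' \<in> lattice V"
  shows "u + u' \<in> lattice V \<longleftrightarrow> u \<in> lattice V"
proof -
  have "a + b \<in> V \<longleftrightarrow> a \<in> V" if "b \<in> V" for a b
  proof -
    have "- b \<in> V" using V that by (metis diff_0)
    then have "a + b \<in> V" if "a \<in> V"
      using V(2) that by (metis diff_minus_eq_add)
    moreover have "a \<in> V" if "a + b \<in> V"
      using V(2) \<open>b \<in> V\<close> that by (metis add_diff_cancel_right')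
    ultimately show ?thesis by blast
  qed
  then show ?thesis
    using u' add_mem_X_iff[of u' u] by (auto simp: lattice_def coord_add)
qed

lemma lattice_indicator_in_Cc:
  assumes V: "openin TF V" "compactin TF V" "0 \<in> V" "\<forall>a\<in>V. \<forall>b\<in>V. a - b \<in> V"
  shows "(\<lambda>u. if u \<in> lattice V then 1 else 0) \<in> Cc"
  unfolding mem_Cc_iff
proof (intro conjI)
  note coset = lattice_add_mem_iff[OF V(3,4)]
  show "locally_constant_on TX (\<lambda>u. if u \<in> lattice V then 1 else (0 :: 'r))"
  proof (rule locally_constant_onI)
    fix x assume "x \<in> topspace TX"
    then have x: "x \<in> X" "- x \<in> X"
      using X_subspace subspace_neg by (auto simp: topspace_TX)
    \<comment> \<open>This is the coset of \<open>x\<close>: an open neighbourhood on which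
      membership in \<open>lattice V\<close> does not change.\<close>
    let ?U = "{u \<in> topspace TX. u + - x \<in> lattice V}"
    have "openin TX ?U"
      using continuous_translation[OF x(2)] openin_lattice[OF V(1)] by (rule openin_continuous_map_preimage)
    moreover have "x \<in> ?U"
      using x V(3) X_subspace subspace_0 by (auto simp: topspace_TX lattice_def representation_zero)
    moreover have "(if u \<in> lattice V then 1 else 0) = (if x \<in> lattice V then 1 else (0 :: 'r))" if "u \<in> ?U" for u
      using coset[of "u + - x" x] that by simp
    ultimately show "\<exists>U. openin TX U \<and> x \<in> U \<and>
        (\<forall>y\<in>U. (if y \<in> lattice V then 1 else 0) = (if x \<in> lattice V then 1 else (0 :: 'r)))"
      by (intro exI[of _ ?U]) blast
  qed
  have "{u \<in> X. (if u \<in> lattice V then 1 else 0) \<noteq> (0 :: 'r)} = lattice V"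
    by (auto simp: lattice_def)
  then show "compactin TX {u \<in> X. (if u \<in> lattice V then 1 else 0) \<noteq> (0 :: 'r)}"
    using compactin_lattice[OF V(2)] by simp
qed (auto simp: lattice_def)

lemma zero_in_lattice: "0 \<in> V \<Longrightarrow> 0 \<in> lattice V"
  using X_subspace subspace_0 by (auto simp: lattice_def representation_zero)

text \<open>Some coordinate of \<open>x\<close> is nonzero, and a compact open subgroup
  \<open>V\<close> can avoid it; the indicator of \<open>lattice V\<close> separates 0 from
  \<open>x\<close>.\<close>

lemma exists_Cc_separating:
  assumes "x \<in> X" "x \<noteq> 0"
  shows "\<exists>\<phi>\<in>Cc. \<phi> 0 \<noteq> 0 \<and> \<phi> x = 0"
proof -
  obtain b where b: "b \<in> X_basis" "coord x b \<noteq> 0"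
    using assms coord_eq_0_imp by blast
  then obtain U where U: "openin TF U" "0 \<in> U" "coord x b \<notin> U"
    using TF_separation by blast
  then obtain V where V: "V \<subseteq> U" "openin TF V" "compactin TF V" "0 \<in> V" "\<forall>a\<in>V. \<forall>b\<in>V. a - b \<in> V"
    using TF_compact_open_subgroup[OF U(1,2)] by blast
  then have "x \<notin> lattice V"
    using b U by (auto simp: lattice_def)
  then show ?thesis
    using lattice_indicator_in_Cc[OF V(2-5)] zero_in_lattice[OF V(4)]
    by (intro bexI[of _ "\<lambda>u. if u \<in> lattice V then 1 else 0"]) auto
qed

lemma exists_Cc_nonzero_at:
  assumes "u \<in> X" shows "\<exists>\<phi>\<in>Cc. \<phi> u \<noteq> 0"
proof -
  obtain V where V: "openin TF V" "compactin TF V" "0 \<in> V" "\<forall>a\<in>V. \<forall>b\<in>V. a - b \<in> V"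
    using TF_compact_open_subgroup[of UNIV] openin_topspace[of TF] by (auto simp: topspace_TF)
  have "- u \<in> X" using assms X_subspace subspace_neg by blast
  from Cc_translate[OF lattice_indicator_in_Cc[OF V] this] zero_in_lattice[OF V(3)]
  show ?thesis
    by (intro bexI[of _ "\<lambda>x. if x + - u \<in> lattice V then 1 else 0"]) auto
qed

section \<open>The operators \<open>U0\<close> and the group \<open>GL_Cc\<close>\<close>

lemma U0_apply: "\<phi> \<in> Cc \<Longrightarrow> U0 (w, r) \<phi> = (\<lambda>u. r * psi (form u (prY w)) * \<phi> (u + prX w))"
  by (simp add: U0_def)

lemma U0_in_Cc:
  assumes "\<phi> \<in> Cc" shows "U0 (w, r) \<phi> \<in> Cc"
proof -
  have "(\<lambda>u. r * (psi (form u (prY w)) * \<phi> (u + prX w))) \<in> Cc"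
    using assms prX_in by (intro Cc_scale Cc_character_mult Cc_translate)
  then show ?thesis
    using assms by (simp add: U0_apply mult.assoc)
qed

text \<open>The inner character is evaluated at \<open>u + prX w\<close>, and the translation
  contributes \<open>form (prX w) (prY w')\<close>, which is the cocycle of
  \<open>AW\<close>.\<close>

lemma U0_mult:
  assumes "\<phi> \<in> Cc"
  shows "U0 (w, r) (U0 (w', r') \<phi>) = U0 (w + w', r * r' * psi (polB w w')) \<phi>"
  by (subst U0_apply[OF U0_in_Cc[OF assms]])
    (simp add: U0_apply[OF assms] fun_eq_iff prX_add prY_add form_add_left form_add_right psi_add
      polB_def algebra_simps)

lemma U0_one: "\<phi> \<in> Cc \<Longrightarrow> U0 (0, 1) \<phi> = \<phi>"
  by (simp add: U0_apply prX_zero prY_zero form_zero psi_0)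

lemma U0_scalar: "\<phi> \<in> Cc \<Longrightarrow> U0 (w, c * r) \<phi> = (\<lambda>u. c * U0 (w, r) \<phi> u)"
  by (simp add: U0_apply mult.assoc)

lemma U0_linear:
  assumes "\<phi> \<in> Cc"
  shows "\<theta> \<in> Cc \<Longrightarrow> U0 a (\<lambda>u. \<phi> u + \<theta> u) = (\<lambda>u. U0 a \<phi> u + U0 a \<theta> u)"
    and "U0 a (\<lambda>u. c * \<phi> u) = (\<lambda>u. c * U0 a \<phi> u)"
  using assms by (cases a; simp add: U0_apply Cc_add Cc_scale algebra_simps)+

lemma mem_GL_Cc_iff:
  "g \<in> carrier GL_Cc \<longleftrightarrow> g \<in> Bij Cc \<and>
     (\<forall>\<phi>\<in>Cc. \<forall>\<theta>\<in>Cc. g (\<lambda>u. \<phi> u + \<theta> u) = (\<lambda>u. g \<phi> u + g \<theta> u)) \<and>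
     (\<forall>c. \<forall>\<phi>\<in>Cc. g (\<lambda>u. c * \<phi> u) = (\<lambda>u. c * g \<phi> u))"
  by (simp add: GL_Cc_def)

lemma GL_Cc_in_Cc: "g \<in> carrier GL_Cc \<Longrightarrow> \<phi> \<in> Cc \<Longrightarrow> g \<phi> \<in> Cc"
  using Bij_imp_funcset by (fastforce simp: mem_GL_Cc_iff)

lemma U0_in_GL_Cc:
  assumes "r \<noteq> 0" shows "U0 (w, r) \<in> carrier GL_Cc"
proof -
  \<comment> \<open>The inverse of \<open>(w, r)\<close> in \<open>AW\<close>.\<close>
  let ?a = "(- w, inverse r * psi (polB w w))"
  have pm: "polB w (- w) = - polB w w" "polB (- w) w = - polB w w"
    using polB_add_left[of w "- w" w] polB_add_right[of w w "- w"]
    by (simp_all add: polB_zero eq_neg_iff_add_eq_0 add.commute)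
  have inv: "inverse r * psi (polB w w) * r * inverse (psi (polB w w)) = 1"
    "r * (inverse r * psi (polB w w)) * inverse (psi (polB w w)) = 1"
    using assms psi_nonzero[of "polB w w"] by (simp_all add: field_simps)
  have "bij_betw (U0 (w, r)) Cc Cc"
    by (intro bij_betw_byWitness[where f' = "U0 ?a"]) (auto simp: U0_mult pm psi_minus inv U0_one U0_in_Cc)
  then have "U0 (w, r) \<in> Bij Cc"
    by (simp add: Bij_def U0_def)
  then show ?thesis
    by (auto simp: mem_GL_Cc_iff U0_linear)
qed

lemma group_GL_Cc: "group GL_Cc"
proof -
  have eq: "GL_Cc = (BijGroup Cc)\<lparr>carrier := carrier GL_Cc\<rparr>"
    by (simp add: GL_Cc_def)
  have "subgroup (carrier GL_Cc) (BijGroup Cc)"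
  proof
    show "carrier GL_Cc \<subseteq> carrier (BijGroup Cc)"
      by (auto simp: mem_GL_Cc_iff BijGroup_def)
    show "\<one>\<^bsub>BijGroup Cc\<^esub> \<in> carrier GL_Cc"
      by (auto simp: mem_GL_Cc_iff BijGroup_def id_Bij Cc_add Cc_scale)
    fix g assume g: "g \<in> carrier GL_Cc"
    show "g \<otimes>\<^bsub>BijGroup Cc\<^esub> h \<in> carrier GL_Cc" if h: "h \<in> carrier GL_Cc" for h
      using g h GL_Cc_in_Cc[OF h] compose_Bij[of g Cc h]
      by (auto simp: mem_GL_Cc_iff BijGroup_def compose_Bij compose_def Cc_add Cc_scale)
    have bij: "bij_betw g Cc Cc" using g by (simp add: mem_GL_Cc_iff Bij_def)
    let ?h = "inv_into Cc g"
    have h: "?h \<phi> \<in> Cc" "g (?h \<phi>) = \<phi>" if "\<phi> \<in> Cc" for \<phi>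
      using that bij by (simp_all add: bij_betw_def inv_into_into f_inv_into_f)
    \<comment> \<open>Uniqueness of preimages, from which linearity of the inverse follows.\<close>
    have hI: "?h \<phi> = \<theta>" if "\<theta> \<in> Cc" "g \<theta> = \<phi>" for \<phi> \<theta>
      using that bij by (auto simp: bij_betw_def)
    have "?h (\<lambda>u. \<phi> u + \<theta> u) = (\<lambda>u. ?h \<phi> u + ?h \<theta> u)" if "\<phi> \<in> Cc" "\<theta> \<in> Cc" for \<phi> \<theta>
      using that g by (intro hI) (simp_all add: h Cc_add mem_GL_Cc_iff)
    moreover have "?h (\<lambda>u. c * \<phi> u) = (\<lambda>u. c * ?h \<phi> u)" if "\<phi> \<in> Cc" for c \<phi>
      using that g by (intro hI) (simp_all add: h Cc_scale mem_GL_Cc_iff)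
    ultimately show "inv\<^bsub>BijGroup Cc\<^esub> g \<in> carrier GL_Cc"
      using g by (simp add: mem_GL_Cc_iff inv_BijGroup restrict_inv_into_Bij Cc_add Cc_scale)
  qed
  then show ?thesis
    using subgroup.subgroup_is_group[OF _ group_BijGroup] eq by metis
qed

lemma GL_Cc_mult:
  "g \<in> carrier GL_Cc \<Longrightarrow> h \<in> carrier GL_Cc \<Longrightarrow> g \<otimes>\<^bsub>GL_Cc\<^esub> h = compose Cc g h"
  by (simp add: GL_Cc_def BijGroup_def)

text \<open>Moving the inverse to the other side turns conjugation into an intertwining relation
  that can be checked on functions, without any inverse operator.\<close>

lemma GL_Cc_conj_eq_iff:
  assumes "g \<in> carrier GL_Cc" "x \<in> carrier GL_Cc" "y \<in> carrier GL_Cc"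
  shows "g \<otimes>\<^bsub>GL_Cc\<^esub> x \<otimes>\<^bsub>GL_Cc\<^esub> inv\<^bsub>GL_Cc\<^esub> g = y \<longleftrightarrow> (\<forall>\<phi>\<in>Cc. g (x \<phi>) = y (g \<phi>))"
proof -
  interpret group GL_Cc by (rule group_GL_Cc)
  have "g \<otimes>\<^bsub>GL_Cc\<^esub> x \<otimes>\<^bsub>GL_Cc\<^esub> inv\<^bsub>GL_Cc\<^esub> g = y \<longleftrightarrow> g \<otimes>\<^bsub>GL_Cc\<^esub> x = y \<otimes>\<^bsub>GL_Cc\<^esub> g"
    using assms inv_solve_right'[of y "g \<otimes>\<^bsub>GL_Cc\<^esub> x" g] by auto
  also have "\<dots> \<longleftrightarrow> (\<forall>\<phi>\<in>Cc. g (x \<phi>) = y (g \<phi>))"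
    using assms by (auto simp: GL_Cc_mult compose_def fun_eq_iff restrict_def)
  finally show ?thesis .
qed

text \<open>Functions separating points detect the translation \<open>prX w\<close>, the point 0
  then detects \<open>r\<close>, and the remaining characters of \<open>X\<close> detect
  \<open>prY w\<close> by non-degeneracy of the pairing.\<close>

lemma U0_inj:
  assumes "r \<noteq> 0" "r' \<noteq> 0" and eq: "U0 (w, r) = U0 (w', r')"
  shows "w = w' \<and> r = r'"
proof -
  have *: "r * psi (form u (prY w)) * \<phi> (u + prX w) = r' * psi (form u (prY w')) * \<phi> (u + prX w')"
    if "\<phi> \<in> Cc" for \<phi> u
    using fun_cong[OF fun_cong[OF eq, of \<phi>], of u] that by (simp add: U0_apply)
  have x: "prX w = prX w'"
  proof (rule ccontr)
    assume "prX w \<noteq> prX w'"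
    then obtain \<phi> where \<phi>: "\<phi> \<in> Cc" "\<phi> 0 \<noteq> 0" "\<phi> (prX w - prX w') = 0"
      using exists_Cc_separating[of "prX w - prX w'"] prX_in X_subspace subspace_diff by auto
    \<comment> \<open>At \<open>u = - prX w'\<close> the left side of \<open>*\<close> is a multiple
      of the value at \<open>prX w - prX w'\<close>, hence 0, while the right side is a nonzero
      multiple of the value at 0.\<close>
    then show False
      using *[OF \<phi>(1), of "- prX w'"] assms(2) psi_nonzero by simp
  qed
  have **: "r * psi (form u (prY w)) = r' * psi (form u (prY w'))" if u: "u \<in> X" for u
  proof -
    obtain \<phi> where "\<phi> \<in> Cc" "\<phi> (u + prX w) \<noteq> 0"
      using exists_Cc_nonzero_at[of "u + prX w"] u add_mem_X_iff[OF prX_in[of w], of u] by auto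
    then show ?thesis using *[of \<phi> u] by (simp add: x)
  qed
  have r: "r = r'"
    using **[of 0] X_subspace subspace_0 by (simp add: form_zero psi_0)
  have "prY w - prY w' = 0"
  proof (rule eq_0_if_orthogonal_to_X)
    show "prY w - prY w' \<in> Y"
      using prY_in Y_subspace subspace_diff by blast
    fix u assume u: "u \<in> X"
    have diff: "form a (prY w - prY w') = form a (prY w) - form a (prY w')" for a
      using form_add_right[of a "prY w - prY w'" "prY w'"] by (simp add: algebra_simps)
    show "form u (prY w - prY w') = 0"
    proof (rule psi_eq_1_all)
      fix k
      \<comment> \<open>Scaling \<open>u\<close> promotes an equality of characters to an equality
        of linear functionals.\<close>
      have "scale k u \<in> X" using u X_subspace subspace_scale by blast
      from **[OF this] have "psi (k * form u (prY w)) = psi (k * form u (prY w'))"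
        using assms(1) by (simp add: r form_scale_left)
      then show "psi (k * form u (prY w - prY w')) = 1"
        using psi_nonzero by (simp add: diff right_diff_distrib psi_diff)
    qed
  qed
  then show ?thesis
    using x r by (metis eq_iff_diff_eq_0 prX_plus_prY)
qed

section \<open>The two normalizers\<close>

lemma psi_p_power_trivial: "\<exists>N. \<forall>n\<ge>N. psi (of_nat (p ^ n) * a) = 1"
proof -
  obtain n where n: "psi a ^ (p ^ n) = 1" using psi_p_power_torsion by blast
  have "psi (of_nat (p ^ m) * a) = 1" if "m \<ge> n" for m
  proof -
    have "psi (of_nat (p ^ m) * a) = (psi a ^ (p ^ n)) ^ (p ^ (m - n))"
      using that by (simp only: psi_of_nat flip: power_mult power_add) simp
    then show ?thesis by (simp add: n)
  qed
  then show ?thesis by blast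
qed

lemma p_power_line_eventually_in:
  assumes "openin TX U" "u \<in> U" "x \<in> X"
  shows "\<exists>N. \<forall>n\<ge>N. u + scale (of_nat (p ^ n)) x \<in> U"
proof -
  have "u \<in> X" using assms(1,2) openin_subset topspace_TX by blast
  then have "openin TF {a. u + scale a x \<in> U}"
    using openin_continuous_map_preimage[OF continuous_line assms(1)] assms(3) by (simp add: topspace_TF)
  from TF_power_p[OF this] show ?thesis using assms(2) by simp
qed

lemma U1_eq_U0: "U1 (w, t) = U0 (w, psi (t + polB w w / 2))"
  by (simp add: U1_def U0_def polB_def psi_add)

text \<open>The quadratic term is kept as two successive multiplications by \<open>k\<close>, so
  that triviality of \<open>psi\<close> on \<open>of_nat k * c\<close> passes to
  \<open>of_nat k * (of_nat k * c)\<close> by taking a power.\<close>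

lemma U1_scale_apply:
  assumes "\<phi> \<in> Cc"
  shows "U1 (scale (of_nat k) w, 0) \<phi> u =
    psi (of_nat k * (of_nat k * (polB w w / 2))) * psi (of_nat k * form u (prY w)) * \<phi> (u + scale (of_nat k) (prX w))"
  using assms by (simp add: U1_eq_U0 U0_apply prX_scale prY_scale form_scale_right polB_scale_left polB_scale_right)

text \<open>The translation tends to 0 and both character factors become 1. The bound depends on the
  point \<open>u\<close>, which suffices for the image of a function under an operator about which
  nothing more is known.\<close>

lemma U1_p_power_apply_eventually:
  assumes "\<phi> \<in> Cc" "u \<in> X"
  shows "\<exists>N. \<forall>n\<ge>N. U1 (scale (of_nat (p ^ n)) w, 0) \<phi> u = \<phi> u"
proof -
  have "locally_constant_on TX \<phi>" "u \<in> topspace TX"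
    using assms by (simp_all add: mem_Cc_iff topspace_TX)
  then obtain U where U: "openin TX U" "u \<in> U" "\<forall>y\<in>U. \<phi> y = \<phi> u"
    by (rule locally_constant_onE)
  obtain N1 where N1: "\<forall>n\<ge>N1. u + scale (of_nat (p ^ n)) (prX w) \<in> U"
    using p_power_line_eventually_in[OF U(1,2) prX_in] by blast
  obtain N2 where N2: "\<forall>n\<ge>N2. psi (of_nat (p ^ n) * form u (prY w)) = 1"
    using psi_p_power_trivial by blast
  obtain N3 where N3: "\<forall>n\<ge>N3. psi (of_nat (p ^ n) * (polB w w / 2)) = 1"
    using psi_p_power_trivial by blast
  have "U1 (scale (of_nat (p ^ n)) w, 0) \<phi> u = \<phi> u" if "n \<ge> max N1 (max N2 N3)" for n
  proof -
    have "psi (of_nat (p ^ n) * (of_nat (p ^ n) * (polB w w / 2))) = 1"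
      using N3 that by (subst psi_of_nat) (simp del: of_nat_power)
    then show ?thesis
      using N1 N2 U(3) that by (simp add: U1_scale_apply[OF assms(1)] del: of_nat_power)
  qed
  then show ?thesis by blast
qed

text \<open>Triviality on a box amounts to one open condition on the side for each of the finitely
  many basis vectors.\<close>

lemma exists_lattice_character_trivial:
  "\<exists>V. openin TF V \<and> compactin TF V \<and> 0 \<in> V \<and> (\<forall>a\<in>V. \<forall>b\<in>V. a - b \<in> V) \<and>
       (\<forall>u\<in>lattice V. psi (form u y) = 1)"
proof -
  obtain U where U: "openin TF U" "0 \<in> U" "\<forall>a\<in>U. psi a = 1"
    using psi_trivial_near_0 by blast
  have *: "openin TF {a. \<forall>b\<in>B. form b y * a + 0 \<in> U}" if "finite B" for B
    using that
  proof (induction B)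
    case empty
    then show ?case using openin_topspace[of TF] by (simp add: topspace_TF)
  next
    case (insert b B)
    have "{a. \<forall>b\<in>insert b B. form b y * a + 0 \<in> U}
        = {a. form b y * a + 0 \<in> U} \<inter> {a. \<forall>b\<in>B. form b y * a + 0 \<in> U}"
      by auto
    then show ?case
      using insert.IH openin_TF_affine_preimage[OF U(1)] by (simp only: openin_Int)
  qed
  obtain V where V: "V \<subseteq> {a. \<forall>b\<in>X_basis. form b y * a + 0 \<in> U}"
    "openin TF V" "compactin TF V" "0 \<in> V" "\<forall>a\<in>V. \<forall>b\<in>V. a - b \<in> V"
    using TF_compact_open_subgroup[OF *[OF X_basis(3)]] U(2) by auto
  have "psi (form u y) = 1" if "u \<in> lattice V" for u
  proof -
    have "psi (coord u b * form b y) = 1" if "b \<in> X_basis" for b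
      using \<open>u \<in> lattice V\<close> that V(1) U(3) by (auto simp: lattice_def mult.commute)
    then show ?thesis
      using that by (simp add: form_coord psi_sum lattice_def)
  qed
  then show ?thesis using V(2-5) by blast
qed

text \<open>Here the whole function has to be fixed, since an operator \<open>s\<close> will be
  applied to it. The indicator of a lattice on which the character of \<open>prY w\<close> is
  trivial has this property.\<close>

lemma exists_fixed_by_U1_p_powers:
  "\<exists>\<theta>\<in>Cc. \<theta> \<noteq> (\<lambda>_. 0) \<and> (\<exists>N. \<forall>n\<ge>N. U1 (scale (of_nat (p ^ n)) w, 0) \<theta> = \<theta>)"
proof -
  obtain V where V: "openin TF V" "compactin TF V" "0 \<in> V" "\<forall>a\<in>V. \<forall>b\<in>V. a - b \<in> V"
    and triv: "\<And>u. u \<in> lattice V \<Longrightarrow> psi (form u (prY w)) = 1"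
    using exists_lattice_character_trivial[of "prY w"] by auto
  define \<theta> :: "'w \<Rightarrow> 'r" where "\<theta> u = (if u \<in> lattice V then 1 else 0)" for u
  have \<theta>: "\<theta> \<in> Cc"
    using lattice_indicator_in_Cc[OF V] by (simp add: \<theta>_def[abs_def])
  have \<theta>0: "\<theta> 0 = 1"
    using zero_in_lattice[OF V(3)] by (simp add: \<theta>_def)
  obtain N1 where N1: "\<forall>n\<ge>N1. 0 + scale (of_nat (p ^ n)) (prX w) \<in> lattice V"
    using p_power_line_eventually_in[OF openin_lattice[OF V(1)] zero_in_lattice[OF V(3)] prX_in] by blast
  obtain N3 where N3: "\<forall>n\<ge>N3. psi (of_nat (p ^ n) * (polB w w / 2)) = 1"
    using psi_p_power_trivial by blast
  have "U1 (scale (of_nat (p ^ n)) w, 0) \<theta> = \<theta>" if n: "n \<ge> max N1 N3" for n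
  proof
    fix u
    have 1: "psi (of_nat (p ^ n) * (of_nat (p ^ n) * (polB w w / 2))) = 1"
      using N3 n by (subst psi_of_nat) (simp del: of_nat_power)
    \<comment> \<open>The translation vector lies in the lattice, so it preserves the
      indicator.\<close>
    have 2: "\<theta> (u + scale (of_nat (p ^ n)) (prX w)) = \<theta> u"
      using N1 n lattice_add_mem_iff[OF V(3,4), of "scale (of_nat (p ^ n)) (prX w)" u]
      by (simp add: \<theta>_def del: of_nat_power)
    \<comment> \<open>The character is 1 on the lattice, and off the lattice both sides
      vanish.\<close>
    have 3: "psi (of_nat (p ^ n) * form u (prY w)) * \<theta> u = \<theta> u"
      by (simp add: \<theta>_def triv psi_of_nat del: of_nat_power)
    show "U1 (scale (of_nat (p ^ n)) w, 0) \<theta> u = \<theta> u"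
      by (simp only: U1_scale_apply[OF \<theta>] 1 2 3 mult_1_left)
  qed
  then have "\<exists>N. \<forall>n\<ge>N. U1 (scale (of_nat (p ^ n)) w, 0) \<theta> = \<theta>" by blast
  moreover have "\<theta> \<noteq> (\<lambda>_. 0)" using \<theta>0 by auto
  ultimately show ?thesis
    using \<theta> by blast
qed

section \<open>Heisenberg operators and multipliers of intertwiners\<close>

lemma half_add_half: "b / 2 + b / 2 = (b :: 'f)" and half_add_half_add: "b / 2 + (b / 2 + c) = b + (c :: 'f)"
  by (simp_all add: two_neq_0 flip: add_divide_distrib mult_2 add.assoc)

text \<open>The cocycles \<open>polB w w'\<close> and \<open>form w w' / 2\<close> differ by half
  the symmetrization of \<open>polB\<close>, which is the coboundary of
  \<open>polB w w / 2\<close>.\<close>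

lemma U1_mult:
  assumes "\<phi> \<in> Cc"
  shows "U1 (w, t) (U1 (w', t') \<phi>) = U1 (w + w', t + t' + form w w' / 2) \<phi>"
proof -
  have "psi (t + polB w w / 2) * psi (t' + polB w' w' / 2) * psi (polB w w')
      = psi (t + t' + form w w' / 2 + polB (w + w') (w + w') / 2)"
    by (simp flip: psi_add polB_minus_swap add: polB_add_left polB_add_right add_divide_distrib
        diff_divide_distrib half_add_half half_add_half_add algebra_simps)
  then show ?thesis
    using assms by (simp add: U1_eq_U0 U0_mult)
qed

lemma U1_in_Cc: "\<phi> \<in> Cc \<Longrightarrow> U1 (w, t) \<phi> \<in> Cc"
  by (simp add: U1_eq_U0 U0_in_Cc)

lemma U1_linear: "\<phi> \<in> Cc \<Longrightarrow> U1 a (\<lambda>u. c * \<phi> u) = (\<lambda>u. c * U1 a \<phi> u)"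
  by (cases a) (simp add: U1_eq_U0 U0_linear)

lemma GL_Cc_scalar: "g \<in> carrier GL_Cc \<Longrightarrow> \<phi> \<in> Cc \<Longrightarrow> g (\<lambda>u. c * \<phi> u) = (\<lambda>u. c * g \<phi> u)"
  by (simp add: mem_GL_Cc_iff)

text \<open>Since \<open>form w w = 0\<close>, the operator at the \<open>k\<close>-th multiple of
  \<open>w\<close> is the \<open>k\<close>-th power of the one at \<open>w\<close>, and the
  multiplier is raised to the power \<open>k\<close>.\<close>

lemma intertwiner_power:
  assumes s: "s \<in> carrier GL_Cc"
    and eq: "\<And>\<phi>. \<phi> \<in> Cc \<Longrightarrow> s (U1 (w, 0) \<phi>) = (\<lambda>u. r * U1 (w', 0) (s \<phi>) u)"
    and \<phi>: "\<phi> \<in> Cc"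
  shows "s (U1 (scale (of_nat k) w, 0) \<phi>) = (\<lambda>u. r ^ k * U1 (scale (of_nat k) w', 0) (s \<phi>) u)"
proof (induction k)
  case 0
  have "U1 (0, 0) \<theta> = \<theta>" if "\<theta> \<in> Cc" for \<theta>
    using that by (simp add: U1_eq_U0 polB_zero psi_0 U0_one)
  then show ?case using \<phi> GL_Cc_in_Cc[OF s] by simp
next
  case (Suc k)
  have step: "U1 (w, 0) (U1 (scale (of_nat k) w, 0) \<theta>) = U1 (scale (of_nat (Suc k)) w, 0) \<theta>"
    if "\<theta> \<in> Cc" for \<theta> w
    using that by (simp add: U1_mult form_scale_right form_alternating scale_left_distrib)
  have "s (U1 (scale (of_nat (Suc k)) w, 0) \<phi>) = s (U1 (w, 0) (U1 (scale (of_nat k) w, 0) \<phi>))"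
    by (simp only: step[OF \<phi>])
  also have "\<dots> = (\<lambda>u. r * U1 (w', 0) (s (U1 (scale (of_nat k) w, 0) \<phi>)) u)"
    by (intro eq U1_in_Cc \<phi>)
  also have "\<dots> = (\<lambda>u. r * (r ^ k * U1 (w', 0) (U1 (scale (of_nat k) w', 0) (s \<phi>)) u))"
    by (simp only: Suc.IH U1_linear[OF U1_in_Cc[OF GL_Cc_in_Cc[OF s \<phi>]]])
  finally show ?case
    by (simp only: step[OF GL_Cc_in_Cc[OF s \<phi>]] power_Suc mult.assoc)
qed

text \<open>Take a function fixed by the operators on the side of \<open>w\<close> and a point where
  its image under \<open>s\<close> is nonzero and unchanged on the side of \<open>w'\<close>;
  comparison of values leaves a power of \<open>r\<close> equal to 1.\<close>

lemma intertwiner_multiplier_U1: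
  assumes s: "s \<in> carrier GL_Cc"
    and eq: "\<And>\<phi>. \<phi> \<in> Cc \<Longrightarrow> s (U1 (w, 0) \<phi>) = (\<lambda>u. r * U1 (w', 0) (s \<phi>) u)"
  shows "r \<in> range psi"
proof -
  obtain \<theta> N where \<theta>: "\<theta> \<in> Cc" "\<theta> \<noteq> (\<lambda>_. 0)" and N: "\<forall>n\<ge>N. U1 (scale (of_nat (p ^ n)) w, 0) \<theta> = \<theta>"
    using exists_fixed_by_U1_p_powers[of w] by blast
  have "s \<theta> \<noteq> (\<lambda>_. 0)"
  proof
    assume *: "s \<theta> = (\<lambda>_. 0)"
    have zero: "(\<lambda>_. 0) \<in> Cc" using Cc_scale[OF \<theta>(1), of 0] by simp
    have "s (\<lambda>_. 0) = (\<lambda>_. 0)" using GL_Cc_scalar[OF s zero, of 0] by simp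
    moreover have "inj_on s Cc" using s by (simp add: mem_GL_Cc_iff Bij_def bij_betw_def)
    ultimately show False
      using * \<theta> zero by (metis inj_onD)
  qed
  then obtain u where u: "s \<theta> u \<noteq> 0" by blast
  have s\<theta>: "s \<theta> \<in> Cc" using GL_Cc_in_Cc[OF s \<theta>(1)] .
  then have "u \<in> X" using u by (auto simp: mem_Cc_iff)
  then obtain M where M: "\<forall>n\<ge>M. U1 (scale (of_nat (p ^ n)) w', 0) (s \<theta>) u = s \<theta> u"
    using U1_p_power_apply_eventually[OF s\<theta>] by blast
  have root: "r ^ (p ^ n) = 1"
    if "U1 (scale (of_nat (p ^ n)) w, 0) \<theta> = \<theta>" "U1 (scale (of_nat (p ^ n)) w', 0) (s \<theta>) u = s \<theta> u" for n
    using fun_cong[OF intertwiner_power[OF s eq \<theta>(1), of "p ^ n"], of u] u that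
    by (simp del: of_nat_power)
  show ?thesis
  proof (cases "(of_nat p :: 'f) = 0")
    case True
    have "U1 (0, 0) \<phi> = \<phi>" if "\<phi> \<in> Cc" for \<phi>
      using that by (simp add: U1_eq_U0 polB_zero psi_0 U0_one)
    then have "r ^ p = 1"
      using root[of 1] \<theta>(1) s\<theta> by (simp add: True)
    then show ?thesis by (rule root_of_unity_in_range_psi)
  next
    case False
    have "r ^ (p ^ max M N) = 1"
      using M N by (intro root) (auto simp del: of_nat_power)
    then show ?thesis by (rule p_power_root_of_unity_in_range_psi[OF False])
  qed
qed

lemma intertwiner_multiplier:
  assumes s: "s \<in> carrier GL_Cc"
    and eq: "\<And>\<phi>. \<phi> \<in> Cc \<Longrightarrow> s (U0 (w, psi c) \<phi>) = U0 (w', r) (s \<phi>)"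
  shows "r \<in> range psi"
proof -
  \<comment> \<open>\<open>d\<close> collects the scalars that turn \<open>U0 (w, psi c)\<close>
    into \<open>U1 (w, 0)\<close> and \<open>U0 (w', r)\<close> into a multiple of
    \<open>U1 (w', 0)\<close>.\<close>
  define d where "d = polB w w / 2 - c - polB w' w' / 2"
  have "s (U1 (w, 0) \<phi>) = (\<lambda>u. (r * psi d) * U1 (w', 0) (s \<phi>) u)" if \<phi>: "\<phi> \<in> Cc" for \<phi>
  proof -
    have "U1 (w, 0) = U0 (w, psi (polB w w / 2 - c) * psi c)"
      by (simp add: U1_eq_U0 flip: psi_add)
    then have "s (U1 (w, 0) \<phi>) = (\<lambda>u. psi (polB w w / 2 - c) * U0 (w', r) (s \<phi>) u)"
      using \<phi> by (simp add: U0_scalar GL_Cc_scalar[OF s] U0_in_Cc eq)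
    also have "U0 (w', r) = U0 (w', (r * psi (- (polB w' w' / 2))) * psi (polB w' w' / 2))"
      by (simp add: mult.assoc psi_0 flip: psi_add)
    also have "(\<lambda>u. psi (polB w w / 2 - c) * U0 (w', (r * psi (- (polB w' w' / 2))) * psi (polB w' w' / 2)) (s \<phi>) u)
       = (\<lambda>u. (psi (polB w w / 2 - c) * (r * psi (- (polB w' w' / 2)))) * U1 (w', 0) (s \<phi>) u)"
      by (simp add: U0_scalar[OF GL_Cc_in_Cc[OF s \<phi>]] U1_eq_U0 mult.assoc)
    also have "psi (polB w w / 2 - c) * (r * psi (- (polB w' w' / 2))) = r * psi d"
      by (simp add: d_def mult.left_commute flip: psi_add)
    finally show ?thesis .
  qed
  then obtain e where "r * psi d = psi e"
    using intertwiner_multiplier_U1[OF s] by blast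
  then have "r = psi (e - d)"
    using psi_nonzero[of d] by (simp add: psi_diff eq_divide_eq)
  then show ?thesis by blast
qed

section \<open>The images of the two representations\<close>

text \<open>The image of \<open>U1\<close> sits in that of \<open>U0\<close> as the part whose
  scalar is a value of \<open>psi\<close>, so that preserving it becomes a condition on
  multipliers.\<close>

lemma image_U1: "U1 ` carrier Heis = {U0 (w, psi c) | w c. True}"
proof safe
  fix w c
  have "U0 (w, psi c) = U1 (w, c - polB w w / 2)"
    by (simp add: U1_eq_U0)
  then show "U0 (w, psi c) \<in> U1 ` carrier Heis"
    by (simp add: Heis_def)
qed (auto simp: U1_eq_U0)

lemma image_U0: "U0 ` carrier AW = {U0 (w, r) | w r. r \<noteq> 0}"
  by (auto simp: AW_def)

lemma image_U0_subset: "U0 ` carrier AW \<subseteq> carrier GL_Cc"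
  using U0_in_GL_Cc by (auto simp: image_U0)

lemma image_U1_subset: "U1 ` carrier Heis \<subseteq> U0 ` carrier AW"
  unfolding image_U0 image_U1 using psi_nonzero by blast

lemma U0_conj_eq_iff:
  assumes "s \<in> carrier GL_Cc" "r \<noteq> 0" "r' \<noteq> 0"
  shows "s \<otimes>\<^bsub>GL_Cc\<^esub> U0 (w, r) \<otimes>\<^bsub>GL_Cc\<^esub> inv\<^bsub>GL_Cc\<^esub> s = U0 (w', r') \<longleftrightarrow>
    (\<forall>\<phi>\<in>Cc. s (U0 (w, r) \<phi>) = U0 (w', r') (s \<phi>))"
  using assms by (intro GL_Cc_conj_eq_iff U0_in_GL_Cc)

lemma intertwines_scale:
  assumes s: "s \<in> carrier GL_Cc" and "\<forall>\<phi>\<in>Cc. s (U0 (w, r) \<phi>) = U0 (w', r') (s \<phi>)"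
  shows "\<forall>\<phi>\<in>Cc. s (U0 (w, c * r) \<phi>) = U0 (w', c * r') (s \<phi>)"
  using assms GL_Cc_in_Cc[OF s] by (simp add: U0_scalar GL_Cc_scalar U0_in_Cc)

text \<open>Forward, each operator \<open>U0 (w, r)\<close> is a scalar multiple of one in the image
  of \<open>U1\<close>, and scalars commute with \<open>s\<close>. Backward,
  \<open>intertwiner_multiplier\<close> forces the scalar of the conjugate to be a value of
  \<open>psi\<close>.\<close>

lemma conj_preserves_iff:
  assumes s: "s \<in> carrier GL_Cc"
  shows "(\<forall>h\<in>U1 ` carrier Heis. s \<otimes>\<^bsub>GL_Cc\<^esub> h \<otimes>\<^bsub>GL_Cc\<^esub> inv\<^bsub>GL_Cc\<^esub> s \<in> U1 ` carrier Heis) \<longleftrightarrow>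
    (\<forall>h\<in>U0 ` carrier AW. s \<otimes>\<^bsub>GL_Cc\<^esub> h \<otimes>\<^bsub>GL_Cc\<^esub> inv\<^bsub>GL_Cc\<^esub> s \<in> U0 ` carrier AW)"
    (is "?H \<longleftrightarrow> ?A")
proof
  assume ?H
  show ?A
  proof
    fix h assume "h \<in> U0 ` carrier AW"
    then obtain w r where h: "h = U0 (w, r)" "r \<noteq> 0" by (auto simp: image_U0)
    \<comment> \<open>The scalar 1 is written \<open>psi 0\<close> to match the description of the
      image; the factor \<open>r\<close> is restored afterwards.\<close>
    have "U0 (w, psi 0) \<in> U1 ` carrier Heis" unfolding image_U1 by blast
    with \<open>?H\<close> have "s \<otimes>\<^bsub>GL_Cc\<^esub> U0 (w, psi 0) \<otimes>\<^bsub>GL_Cc\<^esub> inv\<^bsub>GL_Cc\<^esub> s \<in> U1 ` carrier Heis" by blast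
    then obtain w' c where "s \<otimes>\<^bsub>GL_Cc\<^esub> U0 (w, psi 0) \<otimes>\<^bsub>GL_Cc\<^esub> inv\<^bsub>GL_Cc\<^esub> s = U0 (w', psi c)"
      unfolding image_U1 by blast
    then have "\<forall>\<phi>\<in>Cc. s (U0 (w, r * psi 0) \<phi>) = U0 (w', r * psi c) (s \<phi>)"
      using s psi_nonzero by (intro intertwines_scale) (simp_all add: U0_conj_eq_iff)
    then have "s \<otimes>\<^bsub>GL_Cc\<^esub> U0 (w, r) \<otimes>\<^bsub>GL_Cc\<^esub> inv\<^bsub>GL_Cc\<^esub> s = U0 (w', r * psi c)"
      using s h(2) psi_nonzero by (simp add: U0_conj_eq_iff psi_0)
    then show "s \<otimes>\<^bsub>GL_Cc\<^esub> h \<otimes>\<^bsub>GL_Cc\<^esub> inv\<^bsub>GL_Cc\<^esub> s \<in> U0 ` carrier AW"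
      unfolding h(1) image_U0 using h(2) psi_nonzero[of c]
      by (auto intro!: exI[of _ w'] exI[of _ "r * psi c"])
  qed
next
  assume ?A
  show ?H
  proof
    fix h assume "h \<in> U1 ` carrier Heis"
    then obtain w c where h: "h = U0 (w, psi c)" by (auto simp: image_U1)
    then have "h \<in> U0 ` carrier AW" unfolding image_U0 using psi_nonzero by blast
    with \<open>?A\<close> have "s \<otimes>\<^bsub>GL_Cc\<^esub> h \<otimes>\<^bsub>GL_Cc\<^esub> inv\<^bsub>GL_Cc\<^esub> s \<in> U0 ` carrier AW" by blast
    then obtain w' r where r: "s \<otimes>\<^bsub>GL_Cc\<^esub> h \<otimes>\<^bsub>GL_Cc\<^esub> inv\<^bsub>GL_Cc\<^esub> s = U0 (w', r)" "r \<noteq> 0"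
      unfolding image_U0 by blast
    then have "r \<in> range psi"
      using s psi_nonzero by (intro intertwiner_multiplier[of s w c w' r]) (simp_all add: h U0_conj_eq_iff)
    then show "s \<otimes>\<^bsub>GL_Cc\<^esub> h \<otimes>\<^bsub>GL_Cc\<^esub> inv\<^bsub>GL_Cc\<^esub> s \<in> U1 ` carrier Heis"
      unfolding image_U1 r(1) by blast
  qed
qed

lemma BB1_eq_BB0: "BB1 = BB0"
proof -
  interpret group GL_Cc by (rule group_GL_Cc)
  have "s \<in> normalizer GL_Cc (U1 ` carrier Heis) \<longleftrightarrow> s \<in> normalizer GL_Cc (U0 ` carrier AW)" for s
    using conj_preserves_iff[of s] conj_preserves_iff[of "inv\<^bsub>GL_Cc\<^esub> s"]
    unfolding mem_normalizer_iff[OF image_U0_subset] mem_normalizer_iff[OF order_trans[OF image_U1_subset image_U0_subset]]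
    by blast
  then have "normalizer GL_Cc (U1 ` carrier Heis) = normalizer GL_Cc (U0 ` carrier AW)" by blast
  then show ?thesis
    by (simp add: BB0_def BB1_def)
qed

section \<open>The two fibre products\<close>

lemma coset_ker_psi: "ker_psi #>\<^bsub>Heis\<^esub> (w, t) = {(w, t') | t'. psi t' = psi t}"
proof safe
  fix a b assume "(a, b) \<in> ker_psi #>\<^bsub>Heis\<^esub> (w, t)"
  then show "\<exists>t'. (a, b) = (w, t') \<and> psi t' = psi t"
    by (auto simp: r_coset_def ker_psi_def Heis_def form_zero psi_add)
next
  fix t' assume "psi t' = psi t"
  then have "(0, t' - t) \<in> ker_psi" "(w, t') = (0, t' - t) \<otimes>\<^bsub>Heis\<^esub> (w, t)"
    using psi_nonzero by (simp_all add: ker_psi_def psi_diff Heis_def form_zero)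
  then show "(w, t') \<in> ker_psi #>\<^bsub>Heis\<^esub> (w, t)"
    unfolding r_coset_def by blast
qed

lemma carrier_Heis_Mod: "carrier (Heis Mod ker_psi) = {ker_psi #>\<^bsub>Heis\<^esub> (w, t) | w t. True}"
  by (auto simp: FactGroup_def RCOSETS_def Heis_def)

text \<open>\<open>U1\<close> depends on \<open>t\<close> only through \<open>psi t\<close>, so its
  image of a coset is a singleton and \<open>the_elem\<close> is meaningful.\<close>

lemma U1_quot_coset: "U1_quot (ker_psi #>\<^bsub>Heis\<^esub> (w, t)) = U1 (w, t)"
proof -
  have "U1 ` (ker_psi #>\<^bsub>Heis\<^esub> (w, t)) = {U1 (w, t)}"
    unfolding coset_ker_psi by (force simp: U1_eq_U0 psi_add)
  then show ?thesis by (simp add: U1_quot_def)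
qed

lemma inj_on_U1_quot: "inj_on U1_quot (carrier (Heis Mod ker_psi))"
proof (rule inj_onI)
  fix C D assume "C \<in> carrier (Heis Mod ker_psi)" "D \<in> carrier (Heis Mod ker_psi)"
    and eq: "U1_quot C = U1_quot D"
  then obtain w t w' t' where C: "C = ker_psi #>\<^bsub>Heis\<^esub> (w, t)" and D: "D = ker_psi #>\<^bsub>Heis\<^esub> (w', t')"
    unfolding carrier_Heis_Mod by blast
  have "w = w' \<and> psi (t + polB w w / 2) = psi (t' + polB w' w' / 2)"
    using eq psi_nonzero by (intro U0_inj) (simp_all add: C D U1_quot_coset U1_eq_U0)
  then show "C = D"
    using psi_nonzero by (auto simp: C D coset_ker_psi psi_add)
qed

lemma U1_quot_image: "U1_quot ` carrier (Heis Mod ker_psi) = U1 ` carrier Heis"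
proof -
  have "U1_quot ` carrier (Heis Mod ker_psi) = {U1 (w, t) | w t. True}"
    unfolding carrier_Heis_Mod by (force simp: U1_quot_coset)
  then show ?thesis by (auto simp: Heis_def)
qed

lemma act_Heis_coset:
  "act_Heis (\<sigma>, \<gamma>) ` (ker_psi #>\<^bsub>Heis\<^esub> (w, t)) = ker_psi #>\<^bsub>Heis\<^esub> (\<sigma> w, t + \<gamma> w)"
proof
  show "act_Heis (\<sigma>, \<gamma>) ` (ker_psi #>\<^bsub>Heis\<^esub> (w, t)) \<subseteq> ker_psi #>\<^bsub>Heis\<^esub> (\<sigma> w, t + \<gamma> w)"
    by (auto simp: coset_ker_psi act_Heis_def psi_add)
next
  show "ker_psi #>\<^bsub>Heis\<^esub> (\<sigma> w, t + \<gamma> w) \<subseteq> act_Heis (\<sigma>, \<gamma>) ` (ker_psi #>\<^bsub>Heis\<^esub> (w, t))"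
  proof (rule subrelI)
  fix a b assume "(a, b) \<in> ker_psi #>\<^bsub>Heis\<^esub> (\<sigma> w, t + \<gamma> w)"
  then have "a = \<sigma> w" "psi b = psi t * psi (\<gamma> w)"
    by (auto simp: coset_ker_psi psi_add)
  then have "(a, b) = act_Heis (\<sigma>, \<gamma>) (w, b - \<gamma> w)" "(w, b - \<gamma> w) \<in> ker_psi #>\<^bsub>Heis\<^esub> (w, t)"
    using psi_nonzero by (simp_all add: act_Heis_def coset_ker_psi psi_diff)
  then show "(a, b) \<in> act_Heis (\<sigma>, \<gamma>) ` (ker_psi #>\<^bsub>Heis\<^esub> (w, t))" by blast
  qed
qed

section \<open>Conjugation as an intertwining relation\<close>

lemma normalizer_conj_closed:
  assumes "H \<subseteq> carrier GL_Cc" "s \<in> normalizer GL_Cc H" "h \<in> H"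
  shows "s \<otimes>\<^bsub>GL_Cc\<^esub> h \<otimes>\<^bsub>GL_Cc\<^esub> inv\<^bsub>GL_Cc\<^esub> s \<in> H"
  using assms group.mem_normalizer_iff[OF group_GL_Cc] by blast+

lemma inj_on_U0: "inj_on U0 (carrier AW)"
  by (rule inj_onI) (use U0_inj in \<open>auto simp: AW_def\<close>)

lemma carrier_BB0_subset: "s \<in> carrier BB0 \<Longrightarrow> s \<in> carrier GL_Cc"
  by (simp add: BB0_def normalizer_def stabilizer_def)

text \<open>The normalizer condition puts the conjugate in the image of \<open>U0\<close>, and
  \<open>c w\<close> being nonzero puts the candidate in \<open>AW\<close>; injectivity of
  \<open>U0\<close> then eliminates \<open>inv_into\<close>.\<close>

lemma conj0_eq_iff:
  assumes s: "s \<in> carrier BB0" and c: "\<And>w. c w \<noteq> 0"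
  shows "conj0 s = aut_AW \<sigma> c \<longleftrightarrow> (\<forall>w r. r \<noteq> 0 \<longrightarrow> (\<forall>\<phi>\<in>Cc. s (U0 (w, r) \<phi>) = U0 (\<sigma> w, r * c w) (s \<phi>)))"
proof -
  have N: "s \<in> normalizer GL_Cc (U0 ` carrier AW)" using s by (simp add: BB0_def)
  have sG: "s \<in> carrier GL_Cc" using s by (rule carrier_BB0_subset)
  have "(conj0 s = aut_AW \<sigma> c) \<longleftrightarrow> (\<forall>(w, r)\<in>carrier AW.
    inv_into (carrier AW) U0 (s \<otimes>\<^bsub>GL_Cc\<^esub> U0 (w, r) \<otimes>\<^bsub>GL_Cc\<^esub> inv\<^bsub>GL_Cc\<^esub> s) = (\<sigma> w, r * c w))"
    by (auto simp: conj0_def aut_AW_def restrict_eq_restrict_iff)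
  also have "\<dots> \<longleftrightarrow> (\<forall>(w, r)\<in>carrier AW. \<forall>\<phi>\<in>Cc. s (U0 (w, r) \<phi>) = U0 (\<sigma> w, r * c w) (s \<phi>))"
  proof (intro ball_cong refl, clarify)
    fix w r assume a: "(w, r) \<in> carrier AW"
    then have r: "r \<noteq> 0" and b: "(\<sigma> w, r * c w) \<in> carrier AW" using c by (auto simp: AW_def)
    show "inv_into (carrier AW) U0 (s \<otimes>\<^bsub>GL_Cc\<^esub> U0 (w, r) \<otimes>\<^bsub>GL_Cc\<^esub> inv\<^bsub>GL_Cc\<^esub> s) = (\<sigma> w, r * c w)
      \<longleftrightarrow> (\<forall>\<phi>\<in>Cc. s (U0 (w, r) \<phi>) = U0 (\<sigma> w, r * c w) (s \<phi>))"
      using inv_into_eq_iff[OF inj_on_U0 normalizer_conj_closed[OF image_U0_subset N imageI[OF a]] b]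
        U0_conj_eq_iff[OF sG r, of "r * c w"] r c by simp
  qed
  finally show ?thesis by (auto simp: AW_def)
qed

text \<open>Same elimination of \<open>inv_into\<close>, now on cosets; equality of the two
  normalizers supplies the condition on the image of \<open>U1\<close>.\<close>

lemma conj1_eq_iff:
  assumes s: "s \<in> carrier BB0"
  shows "conj1 s = B1_aut (\<sigma>, \<gamma>) \<longleftrightarrow> (\<forall>w t. \<forall>\<phi>\<in>Cc. s (U1 (w, t) \<phi>) = U1 (\<sigma> w, t + \<gamma> w) (s \<phi>))"
proof -
  have N: "s \<in> normalizer GL_Cc (U1 ` carrier Heis)"
    using s unfolding BB1_eq_BB0[symmetric] by (simp add: BB1_def)
  have sG: "s \<in> carrier GL_Cc" using s by (rule carrier_BB0_subset)
  let ?K = "\<lambda>w t. ker_psi #>\<^bsub>Heis\<^esub> (w, t)"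
  have "(conj1 s = B1_aut (\<sigma>, \<gamma>)) \<longleftrightarrow> (\<forall>w t.
    inv_into (carrier (Heis Mod ker_psi)) U1_quot
      (s \<otimes>\<^bsub>GL_Cc\<^esub> U1_quot (?K w t) \<otimes>\<^bsub>GL_Cc\<^esub> inv\<^bsub>GL_Cc\<^esub> s) = act_Heis (\<sigma>, \<gamma>) ` ?K w t)"
    unfolding conj1_def B1_aut_def restrict_eq_restrict_iff carrier_Heis_Mod by blast
  also have "\<dots> \<longleftrightarrow> (\<forall>w t. \<forall>\<phi>\<in>Cc. s (U1 (w, t) \<phi>) = U1 (\<sigma> w, t + \<gamma> w) (s \<phi>))"
  proof (intro iff_allI)
    fix w t
    have "U1 (w, t) \<in> U1 ` carrier Heis" by (simp add: Heis_def)
    then have mem: "s \<otimes>\<^bsub>GL_Cc\<^esub> U1 (w, t) \<otimes>\<^bsub>GL_Cc\<^esub> inv\<^bsub>GL_Cc\<^esub> s \<in> U1_quot ` carrier (Heis Mod ker_psi)"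
      unfolding U1_quot_image
      using normalizer_conj_closed[OF order_trans[OF image_U1_subset image_U0_subset] N] by blast
    have K: "?K (\<sigma> w) (t + \<gamma> w) \<in> carrier (Heis Mod ker_psi)"
      unfolding carrier_Heis_Mod by blast
    show "inv_into (carrier (Heis Mod ker_psi)) U1_quot
      (s \<otimes>\<^bsub>GL_Cc\<^esub> U1_quot (?K w t) \<otimes>\<^bsub>GL_Cc\<^esub> inv\<^bsub>GL_Cc\<^esub> s) = act_Heis (\<sigma>, \<gamma>) ` ?K w t
      \<longleftrightarrow> (\<forall>\<phi>\<in>Cc. s (U1 (w, t) \<phi>) = U1 (\<sigma> w, t + \<gamma> w) (s \<phi>))"
      unfolding act_Heis_coset U1_quot_coset inv_into_eq_iff[OF inj_on_U1_quot mem K]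
      unfolding U1_eq_U0 by (intro U0_conj_eq_iff sG psi_nonzero)
  qed
  finally show ?thesis .
qed

text \<open>Passing from \<open>U1\<close> to \<open>U0\<close> shifts \<open>t\<close> by
  \<open>polB w w / 2\<close> at \<open>w\<close> and by the corresponding term at
  \<open>\<sigma> w\<close>. The difference of the two shifts is \<open>quad \<sigma> w\<close>,
  which explains the factor in \<open>B1_to_B0\<close>.\<close>

lemma conj1_eq_iff_conj0_eq:
  assumes s: "s \<in> carrier BB0"
  shows "conj1 s = B1_aut b \<longleftrightarrow> conj0 s = B1_to_B0 b"
proof -
  obtain \<sigma> \<gamma> where b: "b = (\<sigma>, \<gamma>)" by (cases b)
  have sG: "s \<in> carrier GL_Cc" using s by (rule carrier_BB0_subset)
  let ?c = "\<lambda>w. psi (\<gamma> w) * psi (quad \<sigma> w)"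
  have *: "psi (t + polB w w / 2) * ?c w = psi (t + \<gamma> w + polB (\<sigma> w) (\<sigma> w) / 2)" for t w
    by (simp add: quad_def diff_divide_distrib algebra_simps flip: psi_add)
  have "(\<forall>w t. \<forall>\<phi>\<in>Cc. s (U1 (w, t) \<phi>) = U1 (\<sigma> w, t + \<gamma> w) (s \<phi>)) \<longleftrightarrow>
    (\<forall>w r. r \<noteq> 0 \<longrightarrow> (\<forall>\<phi>\<in>Cc. s (U0 (w, r) \<phi>) = U0 (\<sigma> w, r * ?c w) (s \<phi>)))" (is "?L \<longleftrightarrow> ?R")
  proof
    assume ?R
    then show ?L
      using psi_nonzero unfolding U1_eq_U0 by (simp flip: *)
  next
    assume L: ?L
    show ?R
    proof (intro allI impI)
      fix w and r :: 'r
      have "\<forall>\<phi>\<in>Cc. s (U0 (w, psi (0 + polB w w / 2)) \<phi>) = U0 (\<sigma> w, psi (0 + polB w w / 2) * ?c w) (s \<phi>)"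
        using L unfolding U1_eq_U0 * by blast
      \<comment> \<open>The relations for \<open>U1\<close> only reach scalars in the range of
        \<open>psi\<close>; linearity of \<open>s\<close> extends the one at \<open>t = 0\<close> to
        every \<open>r\<close>.\<close>
      from intertwines_scale[OF sG this, of "r / psi (0 + polB w w / 2)"]
      show "\<forall>\<phi>\<in>Cc. s (U0 (w, r) \<phi>) = U0 (\<sigma> w, r * ?c w) (s \<phi>)"
        using psi_nonzero by (simp flip: mult.assoc)
    qed
  qed
  then show ?thesis
    using conj0_eq_iff[OF s, of ?c \<sigma>] psi_nonzero by (simp add: b conj1_eq_iff[OF s] B1_to_B0_def)
qed

section \<open>The isomorphism from \<open>B1\<close> to \<open>B0\<close>\<close>

lemma mem_Sp_iff:
  "\<sigma> \<in> carrier Sp \<longleftrightarrow> Vector_Spaces.linear scale scale \<sigma> \<and> bij \<sigma> \<and> (\<forall>w w'. form (\<sigma> w) (\<sigma> w') = form w w')"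
  by (simp add: Sp_def)

lemma Sp_add: "\<sigma> \<in> carrier Sp \<Longrightarrow> \<sigma> (w + w') = \<sigma> w + \<sigma> w'"
  by (simp add: mem_Sp_iff Vector_Spaces.linear_iff)

lemma dual_add: "\<tau> \<in> dual \<Longrightarrow> \<tau> (w + w') = \<tau> w + \<tau> w'"
  and dual_scale: "\<tau> \<in> dual \<Longrightarrow> \<tau> (scale k w) = k * \<tau> w"
  by (simp_all add: dual_def Vector_Spaces.linear_iff)

text \<open>The symmetric bilinear form attached to \<open>quad \<sigma>\<close> is the change of
  \<open>polB\<close> under \<open>\<sigma>\<close>; that change is symmetric because
  \<open>\<sigma>\<close> preserves the antisymmetrization of \<open>polB\<close>.\<close>

lemma quad_add:
  assumes \<sigma>: "\<sigma> \<in> carrier Sp"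
  shows "quad \<sigma> (w + w') = quad \<sigma> w + quad \<sigma> w' + (polB (\<sigma> w) (\<sigma> w') - polB w w')"
proof -
  have "form (\<sigma> w) (\<sigma> w') = form w w'" using \<sigma> by (simp add: mem_Sp_iff)
  then have *: "polB (\<sigma> w') (\<sigma> w) = polB (\<sigma> w) (\<sigma> w') - polB w w' + polB w' w"
    by (simp add: algebra_simps flip: polB_minus_swap)
  show ?thesis
    by (simp add: quad_def Sp_add[OF \<sigma>] polB_add_left polB_add_right * add_divide_distrib
        diff_divide_distrib algebra_simps half_add_half half_add_half_add two_neq_0)
qed

text \<open>A telescoping sum; it is the cocycle relation that makes \<open>B1_to_B0\<close>
  multiplicative.\<close>

lemma quad_comp: "quad (\<sigma> \<circ> \<sigma>') w = quad \<sigma>' w + quad \<sigma> (\<sigma>' w)"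
  by (simp add: quad_def diff_divide_distrib)

lemma linear_zero: "Vector_Spaces.linear scale scale \<sigma> \<Longrightarrow> \<sigma> 0 = 0"
  unfolding Vector_Spaces.linear_iff by (metis scale_zero_left)

text \<open>By \<open>quad_add\<close>, the factor \<open>psi (quad \<sigma> w)\<close> compensates
  exactly for the change of the cocycle \<open>polB\<close> under \<open>\<sigma>\<close>, while the
  factor from \<open>\<tau>\<close> is a character of \<open>W\<close>.\<close>

lemma aut_AW_in_auto:
  assumes \<sigma>: "\<sigma> \<in> carrier Sp" and \<tau>: "\<tau> \<in> dual"
  shows "aut_AW \<sigma> (\<lambda>w. psi (\<tau> w) * psi (quad \<sigma> w)) \<in> auto AW" (is "?\<alpha> \<in> _")
proof -
  have bij: "bij \<sigma>" using \<sigma> by (simp add: mem_Sp_iff)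
  let ?c = "\<lambda>w. psi (\<tau> w) * psi (quad \<sigma> w)"
  have c: "?c (w + w') * psi (polB w w') = ?c w * ?c w' * psi (polB (\<sigma> w) (\<sigma> w'))" for w w'
    unfolding quad_add[OF \<sigma>] dual_add[OF \<tau>] by (simp add: algebra_simps flip: psi_add)
  have "?\<alpha> (a \<otimes>\<^bsub>AW\<^esub> b) = ?\<alpha> a \<otimes>\<^bsub>AW\<^esub> ?\<alpha> b" if "a \<in> carrier AW" "b \<in> carrier AW" for a b
    using that psi_nonzero c[of "fst a" "fst b"]
    by (auto simp: aut_AW_def AW_def Sp_add[OF \<sigma>] mult_ac)
  moreover have \<alpha>: "?\<alpha> \<in> carrier AW \<rightarrow> carrier AW"
    using psi_nonzero by (auto simp: aut_AW_def AW_def)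
  ultimately have "?\<alpha> \<in> hom AW AW" by (simp add: hom_def)
  moreover have "bij_betw ?\<alpha> (carrier AW) (carrier AW)"
    using bij psi_nonzero \<alpha>
    by (intro bij_betw_byWitness[where f' = "\<lambda>(w, r). (inv_into UNIV \<sigma> w, r / ?c (inv_into UNIV \<sigma> w))"])
      (auto simp: aut_AW_def AW_def bij_is_inj bij_is_surj surj_f_inv_f)
  ultimately show ?thesis
    by (simp add: auto_def Bij_def aut_AW_def)
qed

lemma B1_to_B0_in_B0:
  assumes "b \<in> carrier B1" shows "B1_to_B0 b \<in> carrier B0"
proof -
  obtain \<sigma> \<gamma> where b: "b = (\<sigma>, \<gamma>)" "\<sigma> \<in> carrier Sp" "\<gamma> \<in> dual"
    using assms by (auto simp: B1_def)
  have "quad \<sigma> 0 = 0" "\<gamma> 0 = 0" "\<sigma> 0 = 0"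
    using b(2) dual_scale[OF b(3), of 0 0] linear_zero[of \<sigma>]
    by (simp_all add: quad_def mem_Sp_iff polB_zero)
  then have "\<forall>r. r \<noteq> 0 \<longrightarrow> B1_to_B0 b (0, r) = (0, r)"
    by (simp add: B1_to_B0_def b aut_AW_def AW_def psi_0)
  then show ?thesis
    using aut_AW_in_auto[OF b(2,3)] b(2,3)
    by (auto simp: B0_def B1_to_B0_def b(1) mult.commute)
qed

lemma B1_to_B0_iso: "B1_to_B0 \<in> iso B1 B0"
proof -
  have bij: "B1_to_B0 b \<in> Bij (carrier AW)" if "b \<in> carrier B1" for b
    using B1_to_B0_in_B0[OF that] by (simp add: B0_def auto_def)
  have "B1_to_B0 (a \<otimes>\<^bsub>B1\<^esub> b) = B1_to_B0 a \<otimes>\<^bsub>B0\<^esub> B1_to_B0 b"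
    if "a \<in> carrier B1" "b \<in> carrier B1" for a b
  proof -
    have "B1_to_B0 a \<otimes>\<^bsub>B0\<^esub> B1_to_B0 b = compose (carrier AW) (B1_to_B0 a) (B1_to_B0 b)"
      using bij[OF that(1)] bij[OF that(2)] by (simp add: B0_def AutoGroup_def BijGroup_def)
    also have "\<dots> = B1_to_B0 (a \<otimes>\<^bsub>B1\<^esub> b)"
      using psi_nonzero
      by (cases a; cases b) (auto simp: B1_def B1_to_B0_def aut_AW_def compose_def AW_def quad_comp psi_add
          fun_eq_iff restrict_def mult_ac)
    finally show ?thesis by simp
  qed
  then have "B1_to_B0 \<in> hom B1 B0"
    using B1_to_B0_in_B0 by (simp add: hom_def)
  moreover have "inj_on B1_to_B0 (carrier B1)"
  proof (rule inj_onI)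
    fix a b assume a: "a \<in> carrier B1" and b: "b \<in> carrier B1" and eq: "B1_to_B0 a = B1_to_B0 b"
    obtain \<sigma> \<gamma> \<sigma>' \<gamma>' where ab: "a = (\<sigma>, \<gamma>)" "b = (\<sigma>', \<gamma>')" "\<gamma> \<in> dual" "\<gamma>' \<in> dual"
      using a b by (auto simp: B1_def)
    have *: "\<sigma> w = \<sigma>' w \<and> psi (\<gamma> w) * psi (quad \<sigma> w) = psi (\<gamma>' w) * psi (quad \<sigma>' w)" for w
      using fun_cong[OF eq, of "(w, 1)"] by (simp add: B1_to_B0_def ab aut_AW_def AW_def)
    then have \<sigma>: "\<sigma> = \<sigma>'" by blast
    have "\<gamma> w - \<gamma>' w = 0" for w
    proof (rule psi_eq_1_all)
      fix k
      \<comment> \<open>Using all multiples of \<open>w\<close> makes the functional recoverable, as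
        \<open>psi\<close> itself need not be injective.\<close>
      have "psi (\<gamma> (scale k w)) = psi (\<gamma>' (scale k w))"
        using *[of "scale k w"] psi_nonzero by (simp add: \<sigma>)
      then show "psi (k * (\<gamma> w - \<gamma>' w)) = 1"
        using psi_nonzero by (simp add: dual_scale ab right_diff_distrib psi_diff)
    qed
    then show "a = b" by (simp add: ab \<sigma> fun_eq_iff)
  qed
  moreover have "carrier B0 \<subseteq> B1_to_B0 ` carrier B1"
  proof
    fix \<alpha> assume "\<alpha> \<in> carrier B0"
    then obtain \<sigma> \<tau> where "\<sigma> \<in> carrier Sp" "\<tau> \<in> dual" "\<alpha> = aut_AW \<sigma> (\<lambda>w. psi (quad \<sigma> w) * psi (\<tau> w))"
      by (auto simp: B0_def)
    then have "(\<sigma>, \<tau>) \<in> carrier B1" "\<alpha> = B1_to_B0 (\<sigma>, \<tau>)"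
      by (simp_all add: B1_def B1_to_B0_def mult.commute)
    then show "\<alpha> \<in> B1_to_B0 ` carrier B1" by blast
  qed
  ultimately show ?thesis
    using B1_to_B0_in_B0 by (auto simp: iso_def bij_betw_def)
qed

lemma B1_to_B0_Sp: "B1_to_B0 (Sp_to_B1 \<sigma>) = Sp_to_B0 \<sigma>"
  by (simp add: B1_to_B0_def Sp_to_B1_def Sp_to_B0_def psi_0)

text \<open>The matching condition defining the pairs is the same on both sides, by the
  compatibility of conjugation with \<open>B1_to_B0\<close> at the image of \<open>\<sigma>\<close>;
  the two groups are thus equal and the identity is the isomorphism.\<close>

lemma FP1_eq_FP0: "FP1 = FP0"
proof -
  have "B1_aut (Sp_to_B1 \<sigma>) = conj1 s \<longleftrightarrow> Sp_to_B0 \<sigma> = conj0 s" if "s \<in> carrier BB0" for \<sigma> s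
    using conj1_eq_iff_conj0_eq[OF that, of "Sp_to_B1 \<sigma>"] by (auto simp: B1_to_B0_Sp)
  then have "{(\<sigma>, s). \<sigma> \<in> carrier Sp \<and> s \<in> carrier BB0 \<and> B1_aut (Sp_to_B1 \<sigma>) = conj1 s}
    = {(\<sigma>, s). \<sigma> \<in> carrier Sp \<and> s \<in> carrier BB0 \<and> Sp_to_B0 \<sigma> = conj0 s}"
    by auto
  then show ?thesis
    by (simp add: FP1_def FP0_def fibre_product_def BB1_eq_BB0)
qed

end

theorem mainTheorem14:
  fixes scale :: "'f::field \<Rightarrow> 'w::ab_group_add \<Rightarrow> 'w"
    and TF :: "'f topology"
    and p :: nat
    and form :: "'w \<Rightarrow> 'w \<Rightarrow> 'f"
    and X Y :: "'w set"
    and psi :: "'f \<Rightarrow> 'r::field"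
  assumes "weil_setting scale TF p form X Y psi"
  shows
    "weil_setting.FP1 scale TF form X Y psi \<cong> weil_setting.FP0 scale TF form X Y psi
     \<and> id \<in> iso (weil_setting.FP1 scale TF form X Y psi) (weil_setting.FP0 scale TF form X Y psi)
     \<and> weil_setting.BB1 scale TF form X Y psi = weil_setting.BB0 scale TF form X Y psi
     \<and> weil_setting.B1_to_B0 form X Y psi
         \<in> iso (weil_setting.B1 scale form) (weil_setting.B0 scale form X Y psi)
     \<and> (\<forall>\<sigma> \<in> carrier (weil_setting.Sp scale form).
          weil_setting.B1_to_B0 form X Y psi (weil_setting.Sp_to_B1 \<sigma>)
            = weil_setting.Sp_to_B0 form X Y psi \<sigma>)
     \<and> (\<forall>s \<in> carrier (weil_setting.BB1 scale TF form X Y psi).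
          \<forall>b \<in> carrier (weil_setting.B1 scale form).
            weil_setting.conj1 scale TF form X Y psi s = weil_setting.B1_aut form psi b
            \<longleftrightarrow> weil_setting.conj0 scale TF form X Y psi s = weil_setting.B1_to_B0 form X Y psi b)"
proof -
  interpret weil_setting scale TF p form X Y psi by fact
  have "id \<in> iso FP1 FP0"
    by (simp add: FP1_eq_FP0 iso_def hom_def)
  then show ?thesis
    using is_isoI B1_to_B0_iso BB1_eq_BB0 B1_to_B0_Sp conj1_eq_iff_conj0_eq by simp
qed

end
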